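(* Let $0<|z_1|,|z_2|<1$. For every $W'\in\mathcal W^0(\mathfrak X^{(1)}_{1\otimes2})$ and $W''\in\mathcal W^0(\mathfrak X^{(2)}_{1\otimes2})$ put $$\varphi(W',W'')=\iota_{1\otimes2}^{-1}\big(\theta^{(1)}_{1\otimes2}(W')\otimes\theta^{(2)}_{1\otimes2}(W'')\big)\in\mathcal B^0 .$$ Then $$L\big(\theta^{(1)}_{1\otimes2}(W');z_1\big)\,L\big(\theta^{(2)}_{1\otimes2}(W'');z_2\big)=\int_{C_{2\otimes1}}\iota_{2\otimes1}\big(\varphi(W',W'')\big).$$ These identities (the generalized harmonic product relations of hyperlogarithms of type $\mathcal M_{0,5}$) are exactly the relations obtained by comparing coefficients in the two factorizations $\hat{\mathcal L}=\hat{\mathcal L}^{(1)}_{1\otimes2}\hat{\mathcal L}^{(2)}_{1\otimes2}=\hat{\mathcal L}^{(2)}_{2\otimes1}\hat{\mathcal L}^{(1)}_{2\otimes1}$ of the normalized fundamental solution of the formal 2KZ equation.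
   Context: Lie algebra: $\mathfrak X$ is the complex Lie algebra generated by $Z_1,Z_{11},Z_2,Z_{22},Z_{12}$ subject only to $[Z_1,Z_2]=[Z_{11},Z_2]=[Z_1,Z_{22}]=0$ and $[Z_{11},Z_{22}]=-[Z_{11},Z_{12}]=[Z_{22},Z_{12}]=-[Z_1-Z_2,Z_{12}]$. Let $\mathfrak X^{(1)}_{1\otimes2},\mathfrak X^{(2)}_{1\otimes2}$ be the Lie subalgebras generated by $\{Z_1,Z_{11},Z_{12}\}$ and $\{Z_2,Z_{22}\}$ (they are free on these generators). For such a subalgebra $\mathfrak A$, $\mathcal W^0(\mathfrak A)$ is the set of words (noncommutative monomials, including the empty word) in its generators not ending with $Z_1$ or $Z_2$. Forms: on $\mathbf P^1\times\mathbf P^1$ with coordinates $(z_1,z_2)$, $\zeta_i=dz_i/z_i$, $\zeta_{ii}=dz_i/(1-z_i)$ ($i=1,2$), $\zeta_{12}=d(z_1z_2)/(1-z_1z_2)$, $\zeta^{(1)}_{12}=z_2dz_1/(1-z_1z_2)$, $\zeta^{(2)}_{12}=z_1dz_2/(1-z_1z_2)$. Shuffle algebras: for an alphabet $B$ of such 1-forms, $S(B)$ is the vector space with basis the words in $B$ (empty word $\mathbf 1$), with concatenation $\circ$, shuffle product, and deconcatenation coproduct $\Delta^*(\omega_1\circ\cdots\circ\omega_s)=\sum_{l=0}^s(\omega_1\circ\cdots\circ\omega_l)\otimes(\omega_{l+1}\circ\cdots\circ\omega_s)$. $A=\{\zeta_1,\zeta_{11},\zeta_2,\zeta_{22},\zeta_{12}\}$;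 $A^{(1)}_{1\otimes2}=\{\zeta_1,\zeta_{11},\zeta^{(1)}_{12}\}$, $A^{(2)}_{1\otimes2}=\{\zeta_2,\zeta_{22}\}$, $A^{(2)}_{2\otimes1}=\{\zeta_2,\zeta_{22},\zeta^{(2)}_{12}\}$, $A^{(1)}_{2\otimes1}=\{\zeta_1,\zeta_{11}\}$; $S^0(\cdot)$ denotes the span of words not ending in $\zeta_1$ or $\zeta_2$. An element $\sum_I c_I\omega_{i_1}\circ\cdots\circ\omega_{i_s}\in S_s(A)$ satisfies Chen's integrability condition if for each $1\le l<s$, $\sum_I c_I\omega_{i_1}\otimes\cdots\otimes(\omega_{i_l}\wedge\omega_{i_{l+1}})\otimes\cdots\otimes\omega_{i_s}=0$ as a multiple differential form. $\mathcal B$ (reduced bar algebra) is the graded span of such elements, and $\mathcal B^0$ the subspace of elements none of whose words ends in $\zeta_1$ or $\zeta_2$. Maps: for $\{i_1,i_2\}=\{1,2\}$, $\Pr^{(i_1)}_{i_1\otimes i_2}:S(A)\to S(A^{(i_1)}_{i_1\otimes i_2})$ is the linear map replacing each letter of a word by its restriction to $dz_{i_2}=0$ ($\zeta_{i_1}\mapsto\zeta_{i_1}$, $\zeta_{i_1i_1}\mapsto\zeta_{i_1i_1}$, $\zeta_{12}\mapsto\zeta^{(i_1)}_{12}$, $\zeta_{i_2},\zeta_{i_2i_2}\mapsto0$), and $\Pr^{(i_2)}_{i_1\otimes i_2}:S(A)\to S(A^{(i_2)}_{i_1\otimes i_2})$ fixes words in $\zeta_{i_2},\zeta_{i_2i_2}$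 and kills all other words; $\iota_{i_1\otimes i_2}=(\Pr^{(i_1)}_{i_1\otimes i_2}\otimes\Pr^{(i_2)}_{i_1\otimes i_2})\circ\Delta^*|_{\mathcal B}$. It is known (shown in the paper) that $\iota_{i_1\otimes i_2}$ restricts to a linear bijection $\mathcal B^0\to S^0(A^{(i_1)}_{i_1\otimes i_2})\otimes S^0(A^{(i_2)}_{i_1\otimes i_2})$. $\theta^{(k)}_{1\otimes2}$ maps a word in the generators of $\mathfrak X^{(k)}_{1\otimes2}$ to the word in $S(A^{(k)}_{1\otimes2})$ obtained by $Z_k\mapsto\zeta_k$, $Z_{kk}\mapsto\zeta_{kk}$, $Z_{12}\mapsto\zeta^{(1)}_{12}$. Integrals: for 1-forms $\omega_1,\dots,\omega_r$ in one variable $t$ (possibly depending on the other variable as a parameter), $\int_0^z\omega_1\circ\cdots\circ\omega_r=\int_0^z\omega_1(t)\int_0^t\omega_2\circ\cdots\circ\omega_r$, $\int_0^z\mathbf 1=1$, extended linearly; $L(\psi;z_1)=\int_0^{z_1}\psi$ (integration in $z_1$, $z_2$ fixed) and $L(\psi;z_2)=\int_0^{z_2}\psi$ (integration in $z_2$, $z_1$ fixed). For $\psi_1\otimes\psi_2\in S^0(A^{(2)}_{2\otimes1})\otimes S^0(A^{(1)}_{2\otimes1})$, $\int_{C_{2\otimes1}}\psi_1\otimes\psi_2=\int_0^{z_2}\psi_1\cdot\int_0^{z_1}\psi_2$ (iterated integral along the path $(0,0)\to(z_1,0)\to(z_1,z_2)$), extended linearly. Formal 2KZ equation: $dG=\Omega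 G$, $\Omega=\zeta_1Z_1+\zeta_{11}Z_{11}+\zeta_2Z_2+\zeta_{22}Z_{22}+\zeta_{12}Z_{12}$; its normalized fundamental solution at the origin is $\mathcal L=\hat{\mathcal L}z_1^{Z_1}z_2^{Z_2}$ with $\hat{\mathcal L}$ holomorphic near $(0,0)$, $\hat{\mathcal L}(0,0)=\mathbf I$; $\hat{\mathcal L}^{(1)}_{1\otimes2},\hat{\mathcal L}^{(2)}_{1\otimes2},\hat{\mathcal L}^{(2)}_{2\otimes1},\hat{\mathcal L}^{(1)}_{2\otimes1}$ are the holomorphic parts of the normalized (at the origin of the differentiated variable) fundamental solutions of $d_{z_1}G=(\zeta_1Z_1+\zeta_{11}Z_{11}+\zeta^{(1)}_{12}Z_{12})G$, $d_{z_2}G=(\zeta_2Z_2+\zeta_{22}Z_{22})G$, $d_{z_2}G=(\zeta_2Z_2+\zeta_{22}Z_{22}+\zeta^{(2)}_{12}Z_{12})G$, $d_{z_1}G=(\zeta_1Z_1+\zeta_{11}Z_{11})G$ respectively. *)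

theory Defs
  imports "HOL-Complex_Analysis.Contour_Integration"
begin

datatype form =
    zeta1
  | zeta11
  | zeta2
  | zeta22
  | zeta12
  | zeta12_1
  | zeta12_2

text \<open>A 1-form is f dz1 + g dz2; coef w False p = f(p), coef w True p = g(p).\<close>
fun coef :: "form \<Rightarrow> bool \<Rightarrow> complex \<times> complex \<Rightarrow> complex" where
  "coef zeta1 k (x,y) = (if k then 0 else 1 / x)"
| "coef zeta11 k (x,y) = (if k then 0 else 1 / (1 - x))"
| "coef zeta2 k (x,y) = (if k then 1 / y else 0)"
| "coef zeta22 k (x,y) = (if k then 1 / (1 - y) else 0)"
| "coef zeta12 k (x,y) = (if k then x / (1 - x*y) else y / (1 - x*y))"
| "coef zeta12_1 k (x,y) = (if k then 0 else y / (1 - x*y))"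
| "coef zeta12_2 k (x,y) = (if k then x / (1 - x*y) else 0)"

definition wedge_coef :: "form \<Rightarrow> form \<Rightarrow> complex \<times> complex \<Rightarrow> complex" where
  "wedge_coef w v p = coef w False p * coef v True p - coef w True p * coef v False p"

definition dom2 :: "(complex \<times> complex) set" where
  "dom2 = {(x,y). x \<noteq> 0 \<and> y \<noteq> 0 \<and> x \<noteq> 1 \<and> y \<noteq> 1 \<and> x*y \<noteq> 1}"

definition alphA :: "form set" where
  "alphA = {zeta1, zeta11, zeta2, zeta22, zeta12}"

type_synonym selt = "form list \<Rightarrow> complex"
type_synonym telt = "form list \<times> form list \<Rightarrow> complex"

definition supp :: "('a \<Rightarrow> complex) \<Rightarrow> 'a set" where
  "supp c = {w. c w \<noteq> 0}"

text \<open>The multiple form  sum_I c_I w_1 (x) ... (x) (w_m /\ w_(m+1)) (x) ... (x) w_s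
  is zero iff all its component functions (external tensor product on
  (C^2)^(s-1), slot j evaluated at point ps j with component ks j) vanish
  on the domain.\<close>
definition chen_hom :: "nat \<Rightarrow> selt \<Rightarrow> bool" where
  "chen_hom s c \<longleftrightarrow>
     (\<forall>m. Suc m < s \<longrightarrow>
        (\<forall>(ps :: nat \<Rightarrow> complex \<times> complex) (ks :: nat \<Rightarrow> bool).
           (\<forall>j. ps j \<in> dom2) \<longrightarrow>
           (\<Sum>w\<in>{w. c w \<noteq> 0 \<and> length w = s}.
               c w * wedge_coef (w ! m) (w ! Suc m) (ps m) *
               (\<Prod>j\<in>{0..<s} - {m, Suc m}. coef (w ! j) (ks j) (ps j))) = 0))"

definition barB :: "selt set" where
  "barB = {c. finite (supp c) \<and> (\<forall>w \<in> supp c. set w \<subseteq> alphA) \<and>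
             (\<forall>s. chen_hom s (\<lambda>w. if length w = s then c w else 0))}"

definition barB0 :: "selt set" where
  "barB0 = {c \<in> barB. \<forall>w \<in> supp c. w = [] \<or> last w \<notin> {zeta1, zeta2}}"

text \<open>Letterwise maps (None = the letter is sent to 0).\<close>
fun pr1_12 :: "form \<Rightarrow> form option" where   (* restriction to dz2 = 0 *)
  "pr1_12 zeta1 = Some zeta1"
| "pr1_12 zeta11 = Some zeta11"
| "pr1_12 zeta12 = Some zeta12_1"
| "pr1_12 _ = None"

fun pr2_12 :: "form \<Rightarrow> form option" where
  "pr2_12 zeta2 = Some zeta2"
| "pr2_12 zeta22 = Some zeta22"
| "pr2_12 _ = None"

fun pr2_21 :: "form \<Rightarrow> form option" where   (* restriction to dz1 = 0 *)
  "pr2_21 zeta2 = Some zeta2"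
| "pr2_21 zeta22 = Some zeta22"
| "pr2_21 zeta12 = Some zeta12_2"
| "pr2_21 _ = None"

fun pr1_21 :: "form \<Rightarrow> form option" where
  "pr1_21 zeta1 = Some zeta1"
| "pr1_21 zeta11 = Some zeta11"
| "pr1_21 _ = None"

definition word_map :: "(form \<Rightarrow> form option) \<Rightarrow> form list \<Rightarrow> form list option" where
  "word_map f w = (if (\<forall>x\<in>set w. f x \<noteq> None) then Some (map (the \<circ> f) w) else None)"

text \<open>(Pr_a (x) Pr_b) o (deconcatenation coproduct), as element of the tensor product
  (functions on pairs of words).\<close>
definition iota_gen :: "(form \<Rightarrow> form option) \<Rightarrow> (form \<Rightarrow> form option) \<Rightarrow> selt \<Rightarrow> telt" where
  "iota_gen f g c = (\<lambda>(u,v). \<Sum>w\<in>supp c. c w *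
       of_nat (card {l. l \<le> length w \<and> word_map f (take l w) = Some u
                                     \<and> word_map g (drop l w) = Some v}))"

definition iota12 :: "selt \<Rightarrow> telt" where
  "iota12 = iota_gen pr1_12 pr2_12"

definition iota21 :: "selt \<Rightarrow> telt" where
  "iota21 = iota_gen pr2_21 pr1_21"

definition tensor_basis :: "form list \<Rightarrow> form list \<Rightarrow> telt" where
  "tensor_basis u v = (\<lambda>p. if p = (u,v) then 1 else 0)"

datatype gen = Z1 | Z11 | Z2 | Z22 | Z12

definition W0_1 :: "gen list set" where
  "W0_1 = {W. set W \<subseteq> {Z1, Z11, Z12} \<and> (W = [] \<or> last W \<noteq> Z1)}"

definition W0_2 :: "gen list set" where
  "W0_2 = {W. set W \<subseteq> {Z2, Z22} \<and> (W = [] \<or> last W \<noteq> Z2)}"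

fun theta_letter1 :: "gen \<Rightarrow> form" where
  "theta_letter1 Z1 = zeta1"
| "theta_letter1 Z11 = zeta11"
| "theta_letter1 Z12 = zeta12_1"
| "theta_letter1 _ = undefined"

fun theta_letter2 :: "gen \<Rightarrow> form" where
  "theta_letter2 Z2 = zeta2"
| "theta_letter2 Z22 = zeta22"
| "theta_letter2 _ = undefined"

definition theta1 :: "gen list \<Rightarrow> form list" where
  "theta1 W = map theta_letter1 W"

definition theta2 :: "gen list \<Rightarrow> form list" where
  "theta2 W = map theta_letter2 W"

fun L1 :: "form list \<Rightarrow> complex \<Rightarrow> complex \<Rightarrow> complex" where
  "L1 [] x y = 1"
| "L1 (w # ws) x y = contour_integral (linepath 0 x) (\<lambda>t. coef w False (t, y) * L1 ws t y)"

fun L2 :: "form list \<Rightarrow> complex \<Rightarrow> complex \<Rightarrow> complex" where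
  "L2 [] x y = 1"
| "L2 (w # ws) x y = contour_integral (linepath 0 y) (\<lambda>t. coef w True (x, t) * L2 ws x t)"

definition int_C21 :: "telt \<Rightarrow> complex \<Rightarrow> complex \<Rightarrow> complex" where
  "int_C21 P x y = (\<Sum>p\<in>supp P. P p * L2 (fst p) x y * L1 (snd p) x y)"

end

theory Submission
  imports Defs "HOL-Analysis.FPS_Convergence"
begin

text \<open>Expanding every iterated integral as a power series in (z1, z2), the left-hand side becomes
  the series of \<Sum>w \<phi>(w) K12(w) and the right-hand side that of \<Sum>w \<phi>(w) K21(w), where
  K12 and K21 are the kernels of the two factorizations of the fundamental solution. Both series
  satisfy the same first-order system z1 \<partial>/\<partial>z1 F = \<Sum>a (z1-part of \<zeta>_a) F_a,
  z2 \<partial>/\<partial>z2 F = \<Sum>a (z2-part of \<zeta>_a) F_a in the left shifts F_a of \<phi>; for K12 the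
  second equation is where Chen's integrability condition enters. As both also agree on z2 = 0,
  induction on the word length shows that they coincide. The formal iterated integrals have
  coefficients bounded by 1, so all series converge on the unit polydisc and evaluation commutes
  with the algebraic operations and with iterated integration.\<close>

unbundle no vec_syntax
notation fps_nth (infixl "$" 75)

section \<open>Bivariate formal power series\<close>

text \<open>P $ i $ j is the coefficient of x^i y^j, where x stands for z1 and y for z2.\<close>
type_synonym fps2 = "complex fps fps"

definition euler_x :: "fps2 \<Rightarrow> fps2" where
  "euler_x P = fps_X * fps_deriv P"

definition swap_vars :: "fps2 \<Rightarrow> fps2" where
  "swap_vars P = Abs_fps (\<lambda>i. Abs_fps (\<lambda>j. P $ j $ i))"

definition euler_y :: "fps2 \<Rightarrow> fps2" where
  "euler_y P = swap_vars (euler_x (swap_vars P))"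

definition prim_x :: "fps2 \<Rightarrow> fps2" where
  "prim_x P = Abs_fps (\<lambda>i. if i = 0 then 0 else fps_const (1 / of_nat i) * P $ i)"

definition const2 :: "complex \<Rightarrow> fps2" where
  "const2 c = fps_const (fps_const c)"

lemma fps2_eqI: "(\<And>i j. P $ i $ j = Q $ i $ j) \<Longrightarrow> P = Q"
  by (simp add: fps_ext)

lemma of_nat_fps_mult_nth [simp]: "(of_nat n * f) $ j = of_nat n * f $ j"
  by (metis fps_mult_left_const_nth fps_of_nat)

lemma euler_x_nth [simp]: "euler_x P $ n = of_nat n * P $ n"
  by (cases n) (simp_all add: euler_x_def fps_X_mult_nth)

lemma swap_vars_nth [simp]: "swap_vars P $ i $ j = P $ j $ i"
  by (simp add: swap_vars_def)

lemma euler_y_nth [simp]: "euler_y P $ i $ j = of_nat j * P $ i $ j"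
  by (simp add: euler_y_def)

lemma prim_x_nth [simp]: "prim_x P $ i = (if i = 0 then 0 else fps_const (1 / of_nat i) * P $ i)"
  by (simp add: prim_x_def)

lemma fps2_mult_nth: "(P * Q) $ i $ j = (\<Sum>k=0..i. \<Sum>l=0..j. P $ k $ l * Q $ (i - k) $ (j - l))"
  by (simp add: fps_mult_nth fps_sum_nth)

lemma swap_vars_swap_vars [simp]: "swap_vars (swap_vars P) = P"
  by (rule fps2_eqI) simp

lemma swap_vars_add [simp]: "swap_vars (P + Q) = swap_vars P + swap_vars Q"
  by (rule fps2_eqI) simp

lemma swap_vars_diff [simp]: "swap_vars (P - Q) = swap_vars P - swap_vars Q"
  by (rule fps2_eqI) simp

lemma swap_vars_0 [simp]: "swap_vars 0 = 0"
  by (rule fps2_eqI) simp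

lemma swap_vars_1 [simp]: "swap_vars 1 = 1"
  by (rule fps2_eqI) (simp add: fps_one_nth)

lemma swap_vars_mult [simp]: "swap_vars (P * Q) = swap_vars P * swap_vars Q"
  by (rule fps2_eqI) (simp only: swap_vars_nth fps2_mult_nth, rule sum.swap)

lemma swap_vars_X: "swap_vars fps_X = fps_const fps_X"
  by (rule fps2_eqI) (auto simp: fps_X_nth)

lemma euler_x_swap_vars: "euler_x (swap_vars P) = swap_vars (euler_y P)"
  by (simp add: euler_y_def)

lemma euler_y_swap_vars: "euler_y (swap_vars P) = swap_vars (euler_x P)"
  by (simp add: euler_y_def)

lemma euler_x_add [simp]: "euler_x (P + Q) = euler_x P + euler_x Q"
  by (simp add: euler_x_def algebra_simps)

lemma euler_x_diff [simp]: "euler_x (P - Q) = euler_x P - euler_x Q"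
  by (simp add: euler_x_def algebra_simps)

lemma euler_x_0 [simp]: "euler_x 0 = 0"
  by (simp add: euler_x_def)

lemma euler_x_1 [simp]: "euler_x 1 = 0"
  by (simp add: euler_x_def)

lemma euler_x_mult: "euler_x (P * Q) = euler_x P * Q + P * euler_x Q"
  by (simp add: euler_x_def fps_deriv_mult algebra_simps)

lemma euler_x_sum: "euler_x (sum f S) = (\<Sum>x\<in>S. euler_x (f x))"
  by (induction S rule: infinite_finite_induct) auto

lemma euler_y_add [simp]: "euler_y (P + Q) = euler_y P + euler_y Q"
  by (simp add: euler_y_def)

lemma euler_y_diff [simp]: "euler_y (P - Q) = euler_y P - euler_y Q"
  by (simp add: euler_y_def)

lemma euler_y_0 [simp]: "euler_y 0 = 0"
  by (simp add: euler_y_def)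

lemma euler_y_1 [simp]: "euler_y 1 = 0"
  by (simp add: euler_y_def)

lemma euler_y_mult: "euler_y (P * Q) = euler_y P * Q + P * euler_y Q"
  by (simp add: euler_y_def euler_x_mult)

lemma euler_y_sum: "euler_y (sum f S) = (\<Sum>x\<in>S. euler_y (f x))"
  by (induction S rule: infinite_finite_induct) auto

lemma euler_x_euler_y: "euler_x (euler_y P) = euler_y (euler_x P)"
  by (rule fps2_eqI) (simp add: algebra_simps)

lemma const2_add: "const2 (a + b) = const2 a + const2 b"
  by (simp add: const2_def)

lemma const2_diff: "const2 (a - b) = const2 a - const2 b"
  by (simp add: const2_def)

lemma const2_0 [simp]: "const2 0 = 0"
  by (simp add: const2_def)

lemma const2_1 [simp]: "const2 1 = 1"
  by (simp add: const2_def)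

lemma const2_mult: "const2 (a * b) = const2 a * const2 b"
  by (simp add: const2_def)

lemma const2_of_nat: "const2 (of_nat n) = of_nat n"
  by (simp add: const2_def fps_of_nat)

lemma const2_eq_0_iff [simp]: "const2 c = 0 \<longleftrightarrow> c = 0"
  by (simp add: const2_def)

lemma euler_x_const2 [simp]: "euler_x (const2 c) = 0"
  by (simp add: euler_x_def const2_def)

lemma euler_y_const2 [simp]: "euler_y (const2 c) = 0"
  by (rule fps2_eqI) (simp add: const2_def)

lemma euler_x_const2_mult: "euler_x (const2 c * P) = const2 c * euler_x P"
  by (simp add: euler_x_mult euler_x_def const2_def)

lemma euler_y_const2_mult: "euler_y (const2 c * P) = const2 c * euler_y P"
  by (rule fps2_eqI) (simp add: const2_def fps_mult_left_const_nth)

lemma euler_x_prim_x: "euler_x (prim_x P) = P - fps_const (P $ 0)"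
  by (rule fps2_eqI) auto

lemma mult_nth_0: "(P * Q) $ 0 = P $ 0 * Q $ 0"
  by (simp add: fps_mult_nth)

lemma euler_x_eq_0_imp_eq_0:
  assumes "euler_x P = 0" and "P $ 0 = 0"
  shows "P = 0"
proof (rule fps_ext)
  fix i
  have "of_nat i * P $ i = 0"
    using arg_cong[OF assms(1), of "\<lambda>P. P $ i"] by simp
  moreover have "(of_nat i :: complex fps) \<noteq> 0" if "i \<noteq> 0"
    using that by (metis fps_of_nat fps_nth_fps_const of_nat_eq_0_iff)
  ultimately show "P $ i = 0 $ i"
    using assms(2) by (cases "i = 0") auto
qed

definition at_y0 :: "fps2 \<Rightarrow> complex fps" where
  "at_y0 P = Abs_fps (\<lambda>i. P $ i $ 0)"

definition prim :: "complex fps \<Rightarrow> complex fps" where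
  "prim p = Abs_fps (\<lambda>i. if i = 0 then 0 else p $ i / of_nat i)"

lemma at_y0_nth [simp]: "at_y0 P $ i = P $ i $ 0"
  by (simp add: at_y0_def)

lemma at_y0_add [simp]: "at_y0 (P + Q) = at_y0 P + at_y0 Q"
  by (rule fps_ext) simp

lemma at_y0_diff [simp]: "at_y0 (P - Q) = at_y0 P - at_y0 Q"
  by (rule fps_ext) simp

lemma at_y0_0 [simp]: "at_y0 0 = 0"
  by (rule fps_ext) simp

lemma at_y0_1 [simp]: "at_y0 1 = 1"
  by (rule fps_ext) (simp add: fps_one_nth)

lemma at_y0_mult [simp]: "at_y0 (P * Q) = at_y0 P * at_y0 Q"
  by (rule fps_ext) (simp add: fps_mult_nth fps_sum_nth mult_nth_0)

lemma at_y0_const2 [simp]: "at_y0 (const2 c) = fps_const c"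
  by (rule fps_ext) (simp add: const2_def)

lemma at_y0_sum: "at_y0 (sum f S) = (\<Sum>x\<in>S. at_y0 (f x))"
  by (induction S rule: infinite_finite_induct) auto

lemma at_y0_prim_x: "at_y0 (prim_x P) = prim (at_y0 P)"
  by (rule fps_ext) (simp add: prim_def)

lemma prim_0 [simp]: "prim 0 = 0"
  by (rule fps_ext) (simp add: prim_def)

lemma euler_y_eq_0_imp_eq_0:
  assumes "euler_y P = 0" and "at_y0 P = 0"
  shows "P = 0"
proof (rule fps2_eqI)
  fix i j
  have "of_nat j * P $ i $ j = 0"
    using arg_cong[OF assms(1), of "\<lambda>P. P $ i $ j"] by simp
  moreover have "P $ i $ 0 = 0"
    using arg_cong[OF assms(2), of "\<lambda>p. p $ i"] by simp
  ultimately show "P $ i $ j = 0 $ i $ j"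
    by (cases "j = 0") auto
qed

lemma euler_y_cong_nth: "P $ i = Q $ i \<Longrightarrow> euler_y P $ i = euler_y Q $ i"
  by (simp add: fps_eq_iff)

section \<open>Formal iterated integrals\<close>

definition geom_x :: fps2 where
  "geom_x = Abs_fps (\<lambda>i. if i = 0 then 0 else 1)"

definition geom_y :: fps2 where
  "geom_y = swap_vars geom_x"

definition geom_xy :: fps2 where
  "geom_xy = Abs_fps (\<lambda>i. if i = 0 then 0 else fps_X ^ i)"

lemma geom_x_nth [simp]: "geom_x $ i = (if i = 0 then 0 else 1)"
  by (simp add: geom_x_def)

lemma geom_xy_nth [simp]: "geom_xy $ i = (if i = 0 then 0 else fps_X ^ i)"
  by (simp add: geom_xy_def)

lemma swap_vars_geom_xy [simp]: "swap_vars geom_xy = geom_xy"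
  by (rule fps2_eqI) (auto simp: fps_X_power_nth)

lemma one_minus_X_mult_geom_x: "(1 - fps_X) * geom_x = fps_X"
  by (rule fps_ext) (auto simp: algebra_simps fps_X_mult_nth fps_X_nth)

lemma one_minus_Y_mult_geom_y: "(1 - fps_const fps_X) * geom_y = fps_const fps_X"
proof -
  have "swap_vars ((1 - fps_X) * geom_x) = swap_vars fps_X"
    by (simp add: one_minus_X_mult_geom_x)
  thus ?thesis by (simp add: geom_y_def swap_vars_X)
qed

lemma one_minus_XY_mult_geom_xy:
  "(1 - fps_X * fps_const fps_X) * geom_xy = fps_X * fps_const fps_X"
proof (rule fps_ext)
  fix n
  show "((1 - fps_X * fps_const fps_X) * geom_xy) $ n = (fps_X * fps_const fps_X) $ n"
    by (cases n) (auto simp: algebra_simps fps_X_mult_nth fps_X_nth fps_mult_left_const_nth)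
qed

lemma geom_x_mult_geom_y: "geom_x * geom_y = geom_xy + geom_x * geom_xy + geom_y * geom_xy"
proof -
  define X :: fps2 where "X = fps_X"
  define Y :: fps2 where "Y = fps_const fps_X"
  define D where "D = (1 - X) * (1 - Y) * (1 - X * Y)"
  have a: "(1 - X) * geom_x = X" and b: "(1 - Y) * geom_y = Y" and c: "(1 - X * Y) * geom_xy = X * Y"
    using one_minus_X_mult_geom_x one_minus_Y_mult_geom_y one_minus_XY_mult_geom_xy
    by (simp_all add: X_def Y_def)
  have "D * (geom_x * geom_y) = ((1 - X) * geom_x) * ((1 - Y) * geom_y) * (1 - X * Y)"
    by (simp add: D_def algebra_simps)
  also have "\<dots> = X * Y * (1 - X * Y)"
    by (simp add: a b)
  finally have lhs: "D * (geom_x * geom_y) = X * Y * (1 - X * Y)" .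
  have "D * (geom_xy + geom_x * geom_xy + geom_y * geom_xy) =
      (1 - X) * (1 - Y) * ((1 - X * Y) * geom_xy)
      + ((1 - X) * geom_x) * (1 - Y) * ((1 - X * Y) * geom_xy)
      + ((1 - Y) * geom_y) * (1 - X) * ((1 - X * Y) * geom_xy)"
    by (simp add: D_def algebra_simps)
  also have "\<dots> = X * Y * (1 - X * Y)"
    by (simp only: a b c) (simp add: algebra_simps)
  finally have rhs: "D * (geom_xy + geom_x * geom_xy + geom_y * geom_xy) = X * Y * (1 - X * Y)" .
  have "D $ 0 $ 0 = 1"
    by (simp add: D_def X_def Y_def fps_mult_nth fps_X_nth)
  hence "D \<noteq> 0"
    by auto
  with lhs rhs show ?thesis
    by (metis mult_left_cancel)
qed

text \<open>x times the dz1-component of a letter, expanded at the origin.\<close>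
fun x_coef :: "form \<Rightarrow> fps2" where
  "x_coef zeta1 = 1"
| "x_coef zeta11 = geom_x"
| "x_coef zeta12 = geom_xy"
| "x_coef zeta12_1 = geom_xy"
| "x_coef zeta2 = 0"
| "x_coef zeta22 = 0"
| "x_coef zeta12_2 = 0"

fun swap_form :: "form \<Rightarrow> form" where
  "swap_form zeta1 = zeta2"
| "swap_form zeta2 = zeta1"
| "swap_form zeta11 = zeta22"
| "swap_form zeta22 = zeta11"
| "swap_form zeta12 = zeta12"
| "swap_form zeta12_1 = zeta12_2"
| "swap_form zeta12_2 = zeta12_1"

lemma swap_form_swap_form [simp]: "swap_form (swap_form a) = a"
  by (cases a) auto

lemma swap_form_eq_iff: "swap_form a = b \<longleftrightarrow> a = swap_form b"
  by auto

definition y_coef :: "form \<Rightarrow> fps2" where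
  "y_coef a = swap_vars (x_coef (swap_form a))"

lemma y_coef_simps [simp]:
  "y_coef zeta1 = 0" "y_coef zeta11 = 0" "y_coef zeta2 = 1" "y_coef zeta22 = geom_y"
  "y_coef zeta12 = geom_xy" "y_coef zeta12_1 = 0" "y_coef zeta12_2 = geom_xy"
  by (simp_all add: y_coef_def geom_y_def)

text \<open>The formal expansion of L1: dividing the coefficient of x^i by i integrates against dx/x.\<close>
fun L1_fps :: "form list \<Rightarrow> fps2" where
  "L1_fps [] = 1"
| "L1_fps (a # u) = prim_x (x_coef a * L1_fps u)"

definition L2_fps :: "form list \<Rightarrow> fps2" where
  "L2_fps u = swap_vars (L1_fps (map swap_form u))"

lemma L2_fps_Nil [simp]: "L2_fps [] = 1"
  by (simp add: L2_fps_def)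

lemma x_coef_nth_0: "x_coef a $ 0 = (if a = zeta1 then 1 else 0)"
  by (cases a) auto

lemma L1_fps_nth_0: "L1_fps u $ 0 = (if u = [] then 1 else 0)"
  by (cases u) auto

lemma euler_x_L1_fps_Cons:
  "euler_x (L1_fps (a # u)) = x_coef a * L1_fps u - (if a = zeta1 \<and> u = [] then 1 else 0)"
proof -
  have "(x_coef a * L1_fps u) $ 0 = (if a = zeta1 \<and> u = [] then 1 else 0)"
    by (simp add: fps_mult_nth x_coef_nth_0 L1_fps_nth_0)
  thus ?thesis
    by (simp add: euler_x_prim_x)
qed

lemma euler_y_L2_fps_Cons:
  "euler_y (L2_fps (a # u)) = y_coef a * L2_fps u - (if a = zeta2 \<and> u = [] then 1 else 0)"
  unfolding L2_fps_def list.map euler_y_swap_vars euler_x_L1_fps_Cons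
  by (simp add: y_coef_def swap_form_eq_iff)

lemma euler_y_x_coef: "a \<in> alphA \<Longrightarrow> euler_y (x_coef a) = euler_x (y_coef a)"
proof -
  have "euler_y geom_x = 0"
    by (rule fps2_eqI) simp
  moreover have "euler_x geom_y = 0"
    unfolding geom_y_def euler_x_swap_vars by (simp add: \<open>euler_y geom_x = 0\<close>)
  moreover have "euler_y geom_xy = euler_x geom_xy"
    by (rule fps2_eqI) (auto simp: fps_X_power_nth)
  ultimately show "a \<in> alphA \<Longrightarrow> euler_y (x_coef a) = euler_x (y_coef a)"
    by (auto simp: alphA_def)
qed

definition y_free :: "fps2 \<Rightarrow> bool" where
  "y_free P \<longleftrightarrow> (\<forall>i j. 0 < j \<longrightarrow> P $ i $ j = 0)"

lemma y_free_mult: "y_free P \<Longrightarrow> y_free Q \<Longrightarrow> y_free (P * Q)"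
  unfolding y_free_def fps2_mult_nth
  by (auto intro!: sum.neutral) (metis diff_is_0_eq neq0_conv not_le)

lemma y_free_L1_fps: "set u \<subseteq> {zeta1, zeta11} \<Longrightarrow> y_free (L1_fps u)"
proof (induction u)
  case Nil
  thus ?case by (auto simp: y_free_def fps_one_nth)
next
  case (Cons a u)
  have "y_free (x_coef a)"
    using Cons.prems by (auto simp: y_free_def fps_one_nth)
  hence "y_free (x_coef a * L1_fps u)"
    using Cons by (auto intro: y_free_mult)
  thus ?case
    by (auto simp: y_free_def fps_mult_left_const_nth)
qed

lemma euler_y_L1_fps: "set u \<subseteq> {zeta1, zeta11} \<Longrightarrow> euler_y (L1_fps u) = 0"
  using y_free_L1_fps[of u] by (intro fps2_eqI) (force simp: y_free_def)

lemma euler_x_L2_fps: "set v \<subseteq> {zeta2, zeta22} \<Longrightarrow> euler_x (L2_fps v) = 0"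
  unfolding L2_fps_def euler_x_swap_vars by (subst euler_y_L1_fps) auto

section \<open>The two factorization kernels\<close>

lemma word_map_Nil [simp]: "word_map f [] = Some []"
  by (simp add: word_map_def)

lemma word_map_Cons:
  "word_map f (a # u) = (case f a of None \<Rightarrow> None | Some b \<Rightarrow> map_option ((#) b) (word_map f u))"
  by (cases "f a") (auto simp: word_map_def)

lemma word_map_length: "word_map f u = Some u' \<Longrightarrow> length u' = length u"
  by (auto simp: word_map_def split: if_splits)

lemma word_map_range: "word_map f u = Some u' \<Longrightarrow> x \<in> set u' \<Longrightarrow> \<exists>y. f y = Some x"
  by (auto simp: word_map_def split: if_splits) (metis option.collapse)

lemma word_map_dom: "word_map f w = Some v \<Longrightarrow> x \<in> set w \<Longrightarrow> f x \<noteq> None"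
  by (auto simp: word_map_def split: if_splits)

lemma word_map_id: "(\<And>x y. f x = Some y \<Longrightarrow> y = x) \<Longrightarrow> word_map f q = Some v \<Longrightarrow> v = q"
  by (auto simp: word_map_def split: if_splits intro!: map_idI)

lemma word_map_last:
  "word_map f w = Some u \<Longrightarrow> u \<noteq> [] \<Longrightarrow> w \<noteq> [] \<and> f (last w) = Some (last u)"
  by (auto simp: word_map_def last_map split: if_splits)

lemma pr2_12_range: "pr2_12 x = Some y \<Longrightarrow> y \<in> {zeta2, zeta22}"
  by (cases x) auto

lemma pr1_21_range: "pr1_21 x = Some y \<Longrightarrow> y \<in> {zeta1, zeta11}"
  by (cases x) auto

lemma pr2_21_range: "pr2_21 x = Some y \<Longrightarrow> y \<in> {zeta2, zeta22, zeta12_2}"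
  by (cases x) auto

text \<open>split_sum f g X w is X applied to (Pr_f \<otimes> Pr_g) of the deconcatenation coproduct of w.\<close>
definition split_term ::
    "(form \<Rightarrow> form option) \<Rightarrow> (form \<Rightarrow> form option) \<Rightarrow> (form list \<Rightarrow> form list \<Rightarrow> 'r::zero)
      \<Rightarrow> form list \<Rightarrow> nat \<Rightarrow> 'r" where
  "split_term f g X w l = (case word_map f (take l w) of None \<Rightarrow> 0 | Some u \<Rightarrow>
      (case word_map g (drop l w) of None \<Rightarrow> 0 | Some v \<Rightarrow> X u v))"

definition split_sum ::
    "(form \<Rightarrow> form option) \<Rightarrow> (form \<Rightarrow> form option) \<Rightarrow> (form list \<Rightarrow> form list \<Rightarrow> 'r::comm_monoid_add)
      \<Rightarrow> form list \<Rightarrow> 'r" where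
  "split_sum f g X w = (\<Sum>l=0..length w. split_term f g X w l)"

lemma split_term_0: "split_term f g X w 0 = (case word_map g w of None \<Rightarrow> 0 | Some v \<Rightarrow> X [] v)"
  by (simp add: split_term_def)

lemma split_term_Suc_Cons:
  "split_term f g X (a # w) (Suc l) =
     (case f a of None \<Rightarrow> 0 | Some b \<Rightarrow> split_term f g (\<lambda>u v. X (b # u) v) w l)"
  by (cases "f a") (auto simp: split_term_def word_map_Cons split: option.splits)

lemma split_sum_Nil: "split_sum f g X [] = X [] []"
  by (simp add: split_sum_def split_term_def)

lemma split_sum_Cons:
  "split_sum f g X (a # w) = split_term f g X (a # w) 0 +
     (case f a of None \<Rightarrow> 0 | Some b \<Rightarrow> split_sum f g (\<lambda>u v. X (b # u) v) w)"
proof -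
  have "split_sum f g X (a # w) =
      split_term f g X (a # w) 0 + (\<Sum>l=0..length w. split_term f g X (a # w) (Suc l))"
    unfolding split_sum_def by (simp only: length_Cons sum.atLeast0_atMost_Suc_shift o_def)
  thus ?thesis
    by (cases "f a") (simp_all add: split_term_Suc_Cons split_sum_def)
qed

text \<open>M is the boundary term that appears when the left factor is exhausted.\<close>
lemma additive_split_sum_Cons:
  fixes \<theta> :: "'r::comm_ring_1 \<Rightarrow> 'r"
  assumes add: "\<And>P Q. \<theta> (P + Q) = \<theta> P + \<theta> Q" "\<theta> 0 = 0"
    and range: "\<And>x y. g x = Some y \<Longrightarrow> y \<in> R"
    and left_Nil: "\<And>v. set v \<subseteq> R \<Longrightarrow> \<theta> (X [] v) = 0"
    and left_Cons: "\<And>b u v. set v \<subseteq> R \<Longrightarrow>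
      \<theta> (X (b # u) v) = F b * X u v - (if b = e \<and> u = [] then M v else 0)"
  shows "\<theta> (split_sum f g X (a # w)) = (case f a of None \<Rightarrow> 0 | Some b \<Rightarrow>
      F b * split_sum f g X w - (if b = e then (case word_map g w of None \<Rightarrow> 0 | Some v \<Rightarrow> M v) else 0))"
proof -
  have \<theta>_sum: "\<theta> (sum h S) = (\<Sum>x\<in>S. \<theta> (h x))" for h :: "nat \<Rightarrow> 'r" and S
    by (induction S rule: infinite_finite_induct) (auto simp: add)
  have set_v: "word_map g w' = Some v \<Longrightarrow> set v \<subseteq> R" for w' v
    using word_map_range[of g w' v] range by blast
  have term_0: "\<theta> (split_term f g X (a # w) 0) = 0"
    by (auto simp: split_term_0 add left_Nil set_v split: option.splits)
  show ?thesis
  proof (cases "f a")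
    case None
    thus ?thesis by (simp add: split_sum_Cons add term_0)
  next
    case (Some b)
    define B where "B = (case word_map g w of None \<Rightarrow> 0 | Some v \<Rightarrow> M v)"
    have term_l: "\<theta> (split_term f g (\<lambda>u v. X (b # u) v) w l) =
        F b * split_term f g X w l - (if b = e \<and> l = 0 then B else 0)"
      if "l \<in> {0..length w}" for l
    proof (cases "word_map f (take l w)")
      case None
      hence "l \<noteq> 0"
        by (metis take0 word_map_Nil option.distinct(1))
      thus ?thesis
        using None by (simp add: split_term_def add)
    next
      case (Some u)
      have "u = [] \<longleftrightarrow> l = 0"
        using that word_map_length[OF Some] by (cases w) auto
      thus ?thesis
        using Some by (auto simp: split_term_def add left_Cons set_v B_def split: option.splits)
    qed
    have "\<theta> (split_sum f g (\<lambda>u v. X (b # u) v) w) =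
        (\<Sum>l=0..length w. F b * split_term f g X w l - (if b = e \<and> l = 0 then B else 0))"
      unfolding split_sum_def \<theta>_sum by (rule sum.cong) (auto simp: term_l)
    also have "\<dots> = F b * split_sum f g X w - (if b = e then B else 0)"
      by (simp add: sum_subtractf split_sum_def sum_distrib_left)
    finally show ?thesis
      using Some by (simp add: split_sum_Cons add term_0 B_def)
  qed
qed

definition K12 :: "form list \<Rightarrow> fps2" where
  "K12 = split_sum pr1_12 pr2_12 (\<lambda>u v. L1_fps u * L2_fps v)"

definition K21 :: "form list \<Rightarrow> fps2" where
  "K21 = split_sum pr2_21 pr1_21 (\<lambda>u v. L2_fps u * L1_fps v)"

definition L2_pr2_12 :: "form list \<Rightarrow> fps2" where
  "L2_pr2_12 w = (case word_map pr2_12 w of None \<Rightarrow> 0 | Some v \<Rightarrow> L2_fps v)"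

definition L1_pr1_21 :: "form list \<Rightarrow> fps2" where
  "L1_pr1_21 w = (case word_map pr1_21 w of None \<Rightarrow> 0 | Some v \<Rightarrow> L1_fps v)"

lemma K12_Nil [simp]: "K12 [] = 1"
  by (simp add: K12_def split_sum_Nil)

lemma K21_Nil [simp]: "K21 [] = 1"
  by (simp add: K21_def split_sum_Nil)

lemma L2_pr2_12_Nil [simp]: "L2_pr2_12 [] = 1"
  by (simp add: L2_pr2_12_def)

lemma euler_x_K12_Cons:
  assumes "a \<in> alphA"
  shows "euler_x (K12 (a # w)) = x_coef a * K12 w - (if a = zeta1 then L2_pr2_12 w else 0)"
proof -
  have "euler_x (K12 (a # w)) = (case pr1_12 a of None \<Rightarrow> 0 | Some b \<Rightarrow>
      x_coef b * K12 w - (if b = zeta1 then L2_pr2_12 w else 0))"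
    unfolding K12_def L2_pr2_12_def
  proof (rule additive_split_sum_Cons[where R="{zeta2, zeta22}"])
    show "\<And>v. set v \<subseteq> {zeta2, zeta22} \<Longrightarrow> euler_x (L1_fps [] * L2_fps v) = 0"
      by (simp add: euler_x_L2_fps)
    show "\<And>b u v. set v \<subseteq> {zeta2, zeta22} \<Longrightarrow> euler_x (L1_fps (b # u) * L2_fps v) =
        x_coef b * (L1_fps u * L2_fps v) - (if b = zeta1 \<and> u = [] then L2_fps v else 0)"
      by (simp add: euler_x_mult euler_x_L2_fps euler_x_L1_fps_Cons algebra_simps del: L1_fps.simps)
  qed (auto dest: pr2_12_range)
  thus ?thesis
    using assms by (auto simp: alphA_def)
qed

lemma euler_y_K21_Cons:
  assumes "a \<in> alphA"
  shows "euler_y (K21 (a # w)) = y_coef a * K21 w - (if a = zeta2 then L1_pr1_21 w else 0)"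
proof -
  have "euler_y (K21 (a # w)) = (case pr2_21 a of None \<Rightarrow> 0 | Some b \<Rightarrow>
      y_coef b * K21 w - (if b = zeta2 then L1_pr1_21 w else 0))"
    unfolding K21_def L1_pr1_21_def
  proof (rule additive_split_sum_Cons[where R="{zeta1, zeta11}"])
    show "\<And>v. set v \<subseteq> {zeta1, zeta11} \<Longrightarrow> euler_y (L2_fps [] * L1_fps v) = 0"
      by (simp add: euler_y_L1_fps)
    show "\<And>b u v. set v \<subseteq> {zeta1, zeta11} \<Longrightarrow> euler_y (L2_fps (b # u) * L1_fps v) =
        y_coef b * (L2_fps u * L1_fps v) - (if b = zeta2 \<and> u = [] then L1_fps v else 0)"
      by (simp add: euler_y_mult euler_y_L1_fps euler_y_L2_fps_Cons algebra_simps)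
  qed (auto dest: pr1_21_range)
  thus ?thesis
    using assms by (auto simp: alphA_def)
qed

lemma euler_y_L2_pr2_12_Cons:
  "euler_y (L2_pr2_12 (a # w)) =
     (if a \<in> {zeta2, zeta22} then y_coef a * L2_pr2_12 w - (if a = zeta2 \<and> w = [] then 1 else 0)
      else 0)"
proof (cases "a \<in> {zeta2, zeta22}")
  case True
  hence pa: "pr2_12 a = Some a"
    by auto
  show ?thesis
  proof (cases "word_map pr2_12 w")
    case None
    hence "w \<noteq> []"
      by auto
    thus ?thesis
      using True None pa by (simp add: L2_pr2_12_def word_map_Cons)
  next
    case (Some v)
    have "v = [] \<longleftrightarrow> w = []"
      using word_map_length[OF Some] by auto
    thus ?thesis
      using True Some pa by (simp add: L2_pr2_12_def word_map_Cons euler_y_L2_fps_Cons)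
  qed
next
  case False
  hence "pr2_12 a = None"
    by (cases a) auto
  thus ?thesis
    using False by (simp add: L2_pr2_12_def word_map_Cons)
qed

lemma sum_atLeast0_atMost_single:
  fixes f :: "nat \<Rightarrow> 'a::comm_monoid_add"
  assumes "k \<le> m" and "\<And>l. l \<le> m \<Longrightarrow> l \<noteq> k \<Longrightarrow> f l = 0"
  shows "(\<Sum>l=0..m. f l) = f k"
proof -
  have "(\<Sum>l=0..m. f l) = (\<Sum>l\<in>{k}. f l)"
    by (rule sum.mono_neutral_right) (use assms in auto)
  thus ?thesis
    by simp
qed

lemma K12_nth_0: "K12 w $ 0 = L2_pr2_12 w $ 0"
proof -
  have "K12 w $ 0 = (\<Sum>l=0..length w. split_term pr1_12 pr2_12 (\<lambda>u v. L1_fps u * L2_fps v) w l $ 0)"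
    by (simp add: K12_def split_sum_def fps_sum_nth)
  also have "\<dots> = split_term pr1_12 pr2_12 (\<lambda>u v. L1_fps u * L2_fps v) w 0 $ 0"
  proof (rule sum_atLeast0_atMost_single)
    fix l assume l: "l \<le> length w" "l \<noteq> 0"
    show "split_term pr1_12 pr2_12 (\<lambda>u v. L1_fps u * L2_fps v) w l $ 0 = 0"
    proof (cases "word_map pr1_12 (take l w)")
      case (Some u)
      have "u \<noteq> []"
        using word_map_length[OF Some] l by auto
      thus ?thesis
        using Some by (auto simp: split_term_def mult_nth_0 L1_fps_nth_0 split: option.splits)
    qed (simp add: split_term_def)
  qed simp
  also have "\<dots> = L2_pr2_12 w $ 0"
    by (auto simp: split_term_0 L2_pr2_12_def split: option.splits)
  finally show ?thesis .
qed

definition boundary_y0 :: "form list \<Rightarrow> complex fps" where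
  "boundary_y0 w = (case word_map pr1_21 w of None \<Rightarrow> 0 | Some v \<Rightarrow> at_y0 (L1_fps v))"

lemma at_y0_geom_xy [simp]: "at_y0 geom_xy = 0"
  by (rule fps_ext) simp

lemma at_y0_L1_fps: "zeta12_1 \<in> set u \<Longrightarrow> at_y0 (L1_fps u) = 0"
  by (induction u) (auto simp: at_y0_prim_x)

lemma at_y0_L2_fps: "at_y0 (L2_fps v) = (if v = [] then 1 else 0)"
  by (cases v) (auto simp: L2_fps_def fps_eq_iff)

lemma word_map_pr1_21_imp_pr1_12: "word_map pr1_21 w = Some v \<Longrightarrow> word_map pr1_12 w = Some v"
proof (induction w arbitrary: v)
  case (Cons a w)
  thus ?case by (cases a) (auto simp: word_map_Cons split: option.splits)
qed simp

lemma word_map_pr1_12_not_pr1_21: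
  "word_map pr1_12 w = Some u \<Longrightarrow> word_map pr1_21 w = None \<Longrightarrow> zeta12_1 \<in> set u"
proof (induction w arbitrary: u)
  case (Cons a w)
  thus ?case by (cases a) (auto simp: word_map_Cons split: option.splits)
qed simp

text \<open>On y = 0 both kernels collapse to the x-part of the word: in K12 only the full left factor
  survives (and zeta12 restricts to a multiple of y), in K21 only the full right factor.\<close>
lemma at_y0_K12: "at_y0 (K12 w) = boundary_y0 w"
proof -
  have "at_y0 (K12 w) =
      (\<Sum>l=0..length w. at_y0 (split_term pr1_12 pr2_12 (\<lambda>u v. L1_fps u * L2_fps v) w l))"
    by (simp add: K12_def split_sum_def at_y0_sum)
  also have "\<dots> = at_y0 (split_term pr1_12 pr2_12 (\<lambda>u v. L1_fps u * L2_fps v) w (length w))"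
  proof (rule sum_atLeast0_atMost_single)
    fix l assume l: "l \<le> length w" "l \<noteq> length w"
    show "at_y0 (split_term pr1_12 pr2_12 (\<lambda>u v. L1_fps u * L2_fps v) w l) = 0"
    proof (cases "word_map pr2_12 (drop l w)")
      case (Some v)
      have "v \<noteq> []"
        using word_map_length[OF Some] l by auto
      thus ?thesis
        using Some by (auto simp: split_term_def at_y0_L2_fps split: option.splits)
    qed (auto simp: split_term_def split: option.splits)
  qed simp
  also have "\<dots> = (case word_map pr1_12 w of None \<Rightarrow> 0 | Some u \<Rightarrow> at_y0 (L1_fps u))"
    by (auto simp: split_term_def at_y0_L2_fps split: option.splits)
  also have "\<dots> = boundary_y0 w"
    by (cases "word_map pr1_21 w")
      (auto simp: boundary_y0_def at_y0_L1_fps word_map_pr1_21_imp_pr1_12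
        dest: word_map_pr1_12_not_pr1_21 split: option.splits)
  finally show ?thesis .
qed

lemma at_y0_K21: "at_y0 (K21 w) = boundary_y0 w"
proof -
  have "at_y0 (K21 w) =
      (\<Sum>l=0..length w. at_y0 (split_term pr2_21 pr1_21 (\<lambda>u v. L2_fps u * L1_fps v) w l))"
    by (simp add: K21_def split_sum_def at_y0_sum)
  also have "\<dots> = at_y0 (split_term pr2_21 pr1_21 (\<lambda>u v. L2_fps u * L1_fps v) w 0)"
  proof (rule sum_atLeast0_atMost_single)
    fix l assume l: "l \<le> length w" "l \<noteq> 0"
    show "at_y0 (split_term pr2_21 pr1_21 (\<lambda>u v. L2_fps u * L1_fps v) w l) = 0"
    proof (cases "word_map pr2_21 (take l w)")
      case (Some u)
      have "u \<noteq> []"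
        using word_map_length[OF Some] l by auto
      thus ?thesis
        using Some by (auto simp: split_term_def at_y0_L2_fps split: option.splits)
    qed (auto simp: split_term_def split: option.splits)
  qed simp
  also have "\<dots> = boundary_y0 w"
    by (auto simp: split_term_0 boundary_y0_def split: option.splits)
  finally show ?thesis .
qed

section \<open>Chen-reduced word functions and the formal identity\<close>

definition words_upto :: "nat \<Rightarrow> form list set" where
  "words_upto n = {w. set w \<subseteq> alphA \<and> length w \<le> n}"

definition wsum :: "(form list \<Rightarrow> fps2) \<Rightarrow> nat \<Rightarrow> (form list \<Rightarrow> complex) \<Rightarrow> fps2" where
  "wsum K n \<phi> = (\<Sum>w\<in>words_upto n. const2 (\<phi> w) * K w)"

definition supp_within :: "(form list \<Rightarrow> complex) \<Rightarrow> nat \<Rightarrow> bool" where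
  "supp_within \<phi> n \<longleftrightarrow> (\<forall>w. \<phi> w \<noteq> 0 \<longrightarrow> set w \<subseteq> alphA \<and> length w \<le> n)"

definition lshift :: "(form list \<Rightarrow> complex) \<Rightarrow> form \<Rightarrow> form list \<Rightarrow> complex" where
  "lshift \<phi> a = (\<lambda>w. \<phi> (a # w))"

text \<open>The six expressions are the coordinates of the 2-form sum c(a,b) zeta_a \<and> zeta_b in a basis of
  the span of all zeta_a \<and> zeta_b (a, b \<in> A); wedge_rels \<phi> p q is Chen's condition for the
  letters between p and q.\<close>
definition wedge_rels :: "(form list \<Rightarrow> complex) \<Rightarrow> form list \<Rightarrow> form list \<Rightarrow> bool" where
  "wedge_rels \<phi> p q \<longleftrightarrow> (let d = (\<lambda>a b. \<phi> (p @ a # b # q) - \<phi> (p @ b # a # q)) in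
     d zeta1 zeta2 = 0 \<and> d zeta1 zeta22 = 0 \<and> d zeta11 zeta2 = 0 \<and>
     d zeta1 zeta12 - d zeta2 zeta12 + d zeta11 zeta22 = 0 \<and>
     d zeta11 zeta12 + d zeta11 zeta22 = 0 \<and> d zeta11 zeta22 - d zeta22 zeta12 = 0)"

definition chen_reduced :: "(form list \<Rightarrow> complex) \<Rightarrow> bool" where
  "chen_reduced \<phi> \<longleftrightarrow>
     (\<forall>p. \<phi> (p @ [zeta1]) = 0 \<and> \<phi> (p @ [zeta2]) = 0) \<and> (\<forall>p q. wedge_rels \<phi> p q)"

lemma finite_alphA [simp]: "finite alphA"
  by (simp add: alphA_def)

lemma zeta1_in_alphA [simp]: "zeta1 \<in> alphA" and zeta2_in_alphA [simp]: "zeta2 \<in> alphA"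
  by (auto simp: alphA_def)

lemma finite_words_upto [simp]: "finite (words_upto n)"
  unfolding words_upto_def by (rule finite_lists_length_le) simp

lemma words_upto_0: "words_upto 0 = {[]}"
  by (auto simp: words_upto_def)

lemma words_upto_Suc: "words_upto (Suc n) = insert [] (\<Union>a\<in>alphA. (#) a ` words_upto n)"
proof
  show "words_upto (Suc n) \<subseteq> insert [] (\<Union>a\<in>alphA. (#) a ` words_upto n)"
  proof
    fix w assume "w \<in> words_upto (Suc n)"
    thus "w \<in> insert [] (\<Union>a\<in>alphA. (#) a ` words_upto n)"
      by (cases w) (auto simp: words_upto_def)
  qed
qed (auto simp: words_upto_def)

lemma sum_words_upto_Suc:
  "(\<Sum>w\<in>words_upto (Suc n). h w) = h [] + (\<Sum>a\<in>alphA. \<Sum>w\<in>words_upto n. h (a # w))"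
proof -
  have "(\<Sum>w\<in>words_upto (Suc n). h w) = h [] + (\<Sum>w\<in>(\<Union>a\<in>alphA. (#) a ` words_upto n). h w)"
    unfolding words_upto_Suc by (subst sum.insert) auto
  also have "(\<Sum>w\<in>(\<Union>a\<in>alphA. (#) a ` words_upto n). h w) =
      (\<Sum>a\<in>alphA. \<Sum>w\<in>(#) a ` words_upto n. h w)"
    by (rule sum.UNION_disjoint) auto
  also have "\<dots> = (\<Sum>a\<in>alphA. \<Sum>w\<in>words_upto n. h (a # w))"
    by (rule sum.cong[OF refl], subst sum.reindex) (auto simp: inj_on_def)
  finally show ?thesis .
qed

lemma wsum_0: "wsum K 0 \<phi> = const2 (\<phi> []) * K []"
  by (simp add: wsum_def words_upto_0)

lemma wsum_Suc:
  "wsum K (Suc n) \<phi> =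
     const2 (\<phi> []) * K [] + (\<Sum>a\<in>alphA. \<Sum>w\<in>words_upto n. const2 (\<phi> (a # w)) * K (a # w))"
  unfolding wsum_def by (rule sum_words_upto_Suc)

lemma wsum_mono:
  assumes "supp_within \<phi> n" and "n \<le> m"
  shows "wsum K m \<phi> = wsum K n \<phi>"
  unfolding wsum_def
proof (rule sum.mono_neutral_right)
  show "words_upto n \<subseteq> words_upto m"
    using assms(2) by (auto simp: words_upto_def)
  show "\<forall>w\<in>words_upto m - words_upto n. const2 (\<phi> w) * K w = 0"
    using assms(1) by (auto simp: words_upto_def supp_within_def)
qed simp

lemma wsum_supp:
  assumes "supp_within \<phi> n" and "finite (supp \<phi>)"
  shows "wsum K n \<phi> = (\<Sum>w\<in>supp \<phi>. const2 (\<phi> w) * K w)"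
  unfolding wsum_def
proof (rule sum.mono_neutral_right)
  show "supp \<phi> \<subseteq> words_upto n"
    using assms(1) by (auto simp: supp_within_def supp_def words_upto_def)
  show "\<forall>w\<in>words_upto n - supp \<phi>. const2 (\<phi> w) * K w = 0"
    by (auto simp: supp_def)
qed simp

lemma supp_within_lshift: "supp_within \<phi> (Suc n) \<Longrightarrow> supp_within (lshift \<phi> a) n"
  unfolding supp_within_def lshift_def by fastforce

lemma supp_within_0_lshift: "supp_within \<phi> 0 \<Longrightarrow> lshift \<phi> a = (\<lambda>_. 0)"
  by (auto simp: supp_within_def lshift_def fun_eq_iff)

lemma wsum_zero [simp]: "wsum K n (\<lambda>_. 0) = 0"
  by (simp add: wsum_def)

lemma chen_reduced_lshift: "chen_reduced \<phi> \<Longrightarrow> chen_reduced (lshift \<phi> a)"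
  unfolding chen_reduced_def wedge_rels_def lshift_def Let_def
  by (metis append_Cons)

lemma chen_reduced_zeta1_before_y_letters:
  assumes "chen_reduced \<phi>" and "set q \<subseteq> {zeta2, zeta22}"
  shows "\<phi> (p @ zeta1 # q) = 0"
  using assms(2)
proof (induction q arbitrary: p)
  case Nil
  thus ?case using assms(1) by (simp add: chen_reduced_def)
next
  case (Cons b q)
  have "wedge_rels \<phi> p q"
    using assms(1) by (simp add: chen_reduced_def)
  hence "\<phi> (p @ zeta1 # b # q) = \<phi> ((p @ [b]) @ zeta1 # q)"
    using Cons.prems by (auto simp: wedge_rels_def Let_def)
  also have "\<dots> = 0"
    using Cons.IH[of "p @ [b]"] Cons.prems by simp
  finally show ?case .
qed

lemma chen_reduced_zeta2_before_x_letters: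
  assumes "chen_reduced \<phi>" and "set q \<subseteq> {zeta1, zeta11}"
  shows "\<phi> (p @ zeta2 # q) = 0"
  using assms(2)
proof (induction q arbitrary: p)
  case Nil
  thus ?case using assms(1) by (simp add: chen_reduced_def)
next
  case (Cons b q)
  have "wedge_rels \<phi> p q"
    using assms(1) by (simp add: chen_reduced_def)
  hence "\<phi> (p @ zeta2 # b # q) = \<phi> ((p @ [b]) @ zeta2 # q)"
    using Cons.prems by (auto simp: wedge_rels_def Let_def)
  also have "\<dots> = 0"
    using Cons.IH[of "p @ [b]"] Cons.prems by simp
  finally show ?case .
qed

text \<open>x_coef a * y_coef b - y_coef a * x_coef b expands xy times the dz1 \<and> dz2-coefficient of
  \<zeta>_a \<and> \<zeta>_b.\<close>
lemma wedge_rels_formal: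
  assumes "wedge_rels \<phi> p q"
  shows "(\<Sum>a\<in>alphA. \<Sum>b\<in>alphA. const2 (\<phi> (p @ a # b # q)) * (x_coef a * y_coef b - y_coef a * x_coef b)) = 0"
proof -
  define c where "c a b = \<phi> (p @ a # b # q)" for a b
  define d where "d a b = c a b - c b a" for a b
  have rels: "d zeta1 zeta2 = 0" "d zeta1 zeta22 = 0" "d zeta11 zeta2 = 0"
     "d zeta1 zeta12 - d zeta2 zeta12 + d zeta11 zeta22 = 0"
     "d zeta11 zeta12 + d zeta11 zeta22 = 0" "d zeta11 zeta22 - d zeta22 zeta12 = 0"
    using assms unfolding wedge_rels_def Let_def d_def c_def by blast+
  have "(\<Sum>a\<in>alphA. \<Sum>b\<in>alphA. const2 (\<phi> (p @ a # b # q)) * (x_coef a * y_coef b - y_coef a * x_coef b)) =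
     const2 (d zeta1 zeta2) + const2 (d zeta1 zeta22) * geom_y + const2 (d zeta11 zeta2) * geom_x
     + const2 (d zeta1 zeta12 - d zeta2 zeta12 + d zeta11 zeta22) * geom_xy
     + const2 (d zeta11 zeta12 + d zeta11 zeta22) * geom_x * geom_xy
     + const2 (d zeta11 zeta22 - d zeta22 zeta12) * geom_y * geom_xy
     + const2 (d zeta11 zeta22) * (geom_x * geom_y - geom_xy - geom_x * geom_xy - geom_y * geom_xy)"
    unfolding c_def[symmetric] d_def by (simp add: alphA_def const2_diff const2_add algebra_simps)
  also have "\<dots> = 0"
    by (simp add: rels geom_x_mult_geom_y)
  finally show ?thesis .
qed

lemma const2_mult_L2_pr2_12_eq_0:
  assumes "chen_reduced \<phi>"
  shows "const2 (\<phi> (zeta1 # w)) * L2_pr2_12 w = 0"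
proof (cases "word_map pr2_12 w")
  case None
  thus ?thesis by (simp add: L2_pr2_12_def)
next
  case (Some v)
  have "set w \<subseteq> {zeta2, zeta22}"
  proof
    fix x assume "x \<in> set w"
    hence "pr2_12 x \<noteq> None"
      using word_map_dom[OF Some] by blast
    thus "x \<in> {zeta2, zeta22}"
      by (cases x) auto
  qed
  hence "\<phi> ([] @ zeta1 # w) = 0"
    by (rule chen_reduced_zeta1_before_y_letters[OF assms])
  thus ?thesis by simp
qed

lemma const2_mult_L1_pr1_21_eq_0:
  assumes "chen_reduced \<phi>"
  shows "const2 (\<phi> (zeta2 # w)) * L1_pr1_21 w = 0"
proof (cases "word_map pr1_21 w")
  case None
  thus ?thesis by (simp add: L1_pr1_21_def)
next
  case (Some v)
  have "set w \<subseteq> {zeta1, zeta11}"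
  proof
    fix x assume "x \<in> set w"
    hence "pr1_21 x \<noteq> None"
      using word_map_dom[OF Some] by blast
    thus "x \<in> {zeta1, zeta11}"
      by (cases x) auto
  qed
  hence "\<phi> ([] @ zeta2 # w) = 0"
    by (rule chen_reduced_zeta2_before_x_letters[OF assms])
  thus ?thesis by simp
qed

lemma euler_x_wsum_K12_Suc:
  assumes "chen_reduced \<phi>"
  shows "euler_x (wsum K12 (Suc n) \<phi>) = (\<Sum>a\<in>alphA. x_coef a * wsum K12 n (lshift \<phi> a))"
proof -
  have "euler_x (wsum K12 (Suc n) \<phi>) =
      (\<Sum>a\<in>alphA. \<Sum>w\<in>words_upto n. const2 (\<phi> (a # w)) * euler_x (K12 (a # w)))"
    by (simp add: wsum_Suc euler_x_sum euler_x_const2_mult)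
  also have "\<dots> = (\<Sum>a\<in>alphA. \<Sum>w\<in>words_upto n. const2 (\<phi> (a # w)) * (x_coef a * K12 w)
        - (if a = zeta1 then const2 (\<phi> (zeta1 # w)) * L2_pr2_12 w else 0))"
    by (intro sum.cong refl) (auto simp: euler_x_K12_Cons algebra_simps)
  also have "\<dots> = (\<Sum>a\<in>alphA. \<Sum>w\<in>words_upto n. const2 (\<phi> (a # w)) * (x_coef a * K12 w))"
    by (intro sum.cong refl) (auto simp: const2_mult_L2_pr2_12_eq_0[OF assms])
  also have "\<dots> = (\<Sum>a\<in>alphA. x_coef a * wsum K12 n (lshift \<phi> a))"
    by (simp add: wsum_def lshift_def sum_distrib_left algebra_simps)
  finally show ?thesis .
qed

lemma euler_x_wsum_K12:
  assumes "chen_reduced \<phi>" and "supp_within \<phi> n"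
  shows "euler_x (wsum K12 n \<phi>) = (\<Sum>a\<in>alphA. x_coef a * wsum K12 n (lshift \<phi> a))"
proof -
  have "wsum K12 (Suc n) \<phi> = wsum K12 n \<phi>"
    by (rule wsum_mono[OF assms(2)]) simp
  thus ?thesis
    using euler_x_wsum_K12_Suc[OF assms(1), of n] by simp
qed

lemma euler_y_wsum_K21:
  assumes "chen_reduced \<phi>" and "supp_within \<phi> n"
  shows "euler_y (wsum K21 n \<phi>) = (\<Sum>a\<in>alphA. y_coef a * wsum K21 n (lshift \<phi> a))"
proof -
  have "euler_y (wsum K21 (Suc n) \<phi>) =
      (\<Sum>a\<in>alphA. \<Sum>w\<in>words_upto n. const2 (\<phi> (a # w)) * euler_y (K21 (a # w)))"
    by (simp add: wsum_Suc euler_y_sum euler_y_const2_mult)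
  also have "\<dots> = (\<Sum>a\<in>alphA. \<Sum>w\<in>words_upto n. const2 (\<phi> (a # w)) * (y_coef a * K21 w)
        - (if a = zeta2 then const2 (\<phi> (zeta2 # w)) * L1_pr1_21 w else 0))"
    by (intro sum.cong refl) (auto simp: euler_y_K21_Cons algebra_simps)
  also have "\<dots> = (\<Sum>a\<in>alphA. \<Sum>w\<in>words_upto n. const2 (\<phi> (a # w)) * (y_coef a * K21 w))"
    by (intro sum.cong refl) (auto simp: const2_mult_L1_pr1_21_eq_0[OF assms(1)])
  also have "\<dots> = (\<Sum>a\<in>alphA. y_coef a * wsum K21 n (lshift \<phi> a))"
    by (simp add: wsum_def lshift_def sum_distrib_left algebra_simps)
  finally have "euler_y (wsum K21 (Suc n) \<phi>) = (\<Sum>a\<in>alphA. y_coef a * wsum K21 n (lshift \<phi> a))" .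
  moreover have "wsum K21 (Suc n) \<phi> = wsum K21 n \<phi>"
    by (rule wsum_mono[OF assms(2)]) simp
  ultimately show ?thesis
    by simp
qed

lemma wsum_K12_nth_0: "wsum K12 n \<phi> $ 0 = wsum L2_pr2_12 n \<phi> $ 0"
  by (simp add: wsum_def fps_sum_nth mult_nth_0 K12_nth_0)

lemma euler_y_wsum_L2_pr2_12:
  assumes "chen_reduced \<phi>"
  shows "euler_y (wsum L2_pr2_12 (Suc n) \<phi>) =
    (\<Sum>a\<in>alphA. if a \<in> {zeta2, zeta22} then y_coef a * wsum L2_pr2_12 n (lshift \<phi> a) else 0)"
proof -
  have "\<phi> [zeta2] = 0"
    using assms unfolding chen_reduced_def by (metis append_Nil)
  have "euler_y (wsum L2_pr2_12 (Suc n) \<phi>) =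
      (\<Sum>a\<in>alphA. \<Sum>w\<in>words_upto n. const2 (\<phi> (a # w)) * euler_y (L2_pr2_12 (a # w)))"
    by (simp add: wsum_Suc euler_y_sum euler_y_const2_mult)
  also have "\<dots> = (\<Sum>a\<in>alphA. \<Sum>w\<in>words_upto n.
      if a \<in> {zeta2, zeta22} then y_coef a * (const2 (\<phi> (a # w)) * L2_pr2_12 w) else 0)"
    by (intro sum.cong refl) (auto simp: euler_y_L2_pr2_12_Cons \<open>\<phi> [zeta2] = 0\<close> algebra_simps)
  also have "\<dots> = (\<Sum>a\<in>alphA. if a \<in> {zeta2, zeta22} then y_coef a * wsum L2_pr2_12 n (lshift \<phi> a) else 0)"
    by (intro sum.cong refl) (auto simp: wsum_def lshift_def sum_distrib_left)
  finally show ?thesis .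
qed

lemma euler_y_wsum_K12_nth_0:
  assumes "chen_reduced \<phi>"
  shows "euler_y (wsum K12 (Suc n) \<phi>) $ 0 = (\<Sum>a\<in>alphA. y_coef a * wsum K12 n (lshift \<phi> a)) $ 0"
proof -
  have "euler_y (wsum K12 (Suc n) \<phi>) $ 0 = euler_y (wsum L2_pr2_12 (Suc n) \<phi>) $ 0"
    by (rule euler_y_cong_nth) (rule wsum_K12_nth_0)
  also have "\<dots> = (\<Sum>a\<in>alphA.
      if a \<in> {zeta2, zeta22} then y_coef a $ 0 * wsum L2_pr2_12 n (lshift \<phi> a) $ 0 else 0)"
    unfolding euler_y_wsum_L2_pr2_12[OF assms] fps_sum_nth
    by (intro sum.cong refl) (simp add: mult_nth_0)
  also have "\<dots> = (\<Sum>a\<in>alphA. y_coef a $ 0 * wsum K12 n (lshift \<phi> a) $ 0)"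
    by (intro sum.cong refl) (auto simp: alphA_def wsum_K12_nth_0)
  also have "\<dots> = (\<Sum>a\<in>alphA. y_coef a * wsum K12 n (lshift \<phi> a)) $ 0"
    by (simp add: fps_sum_nth mult_nth_0)
  finally show ?thesis .
qed

text \<open>Assuming the y-equation for the shifted word functions, its defect for \<phi> is killed by the
  x-derivative: commuting the Euler operators brings in the mixed terms
  x_coef a * y_coef b - y_coef a * x_coef b, and these cancel by the wedge relations.\<close>
lemma euler_x_K12_defect:
  assumes G: "chen_reduced \<phi>" and B: "supp_within \<phi> (Suc n)"
    and IH: "\<And>a. euler_y (wsum K12 n (lshift \<phi> a)) =
      (\<Sum>b\<in>alphA. y_coef b * wsum K12 n (lshift (lshift \<phi> a) b))"
  shows "euler_x (euler_y (wsum K12 (Suc n) \<phi>) - (\<Sum>a\<in>alphA. y_coef a * wsum K12 n (lshift \<phi> a))) = 0"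
proof -
  define \<Phi> where "\<Phi> = wsum K12 (Suc n) \<phi>"
  define \<Psi> where "\<Psi> a = wsum K12 n (lshift \<phi> a)" for a
  define P where "P a b = wsum K12 n (lshift (lshift \<phi> a) b)" for a b
  have euler_x_\<Psi>: "euler_x (\<Psi> a) = (\<Sum>b\<in>alphA. x_coef b * P a b)" for a
    unfolding \<Psi>_def P_def
    by (rule euler_x_wsum_K12[OF chen_reduced_lshift[OF G] supp_within_lshift[OF B]])
  have euler_x_\<Phi>: "euler_x \<Phi> = (\<Sum>a\<in>alphA. x_coef a * \<Psi> a)"
    unfolding \<Phi>_def \<Psi>_def by (rule euler_x_wsum_K12_Suc[OF G])
  have "euler_x (euler_y \<Phi> - (\<Sum>a\<in>alphA. y_coef a * \<Psi> a)) =
      euler_y (euler_x \<Phi>) - (\<Sum>a\<in>alphA. euler_x (y_coef a) * \<Psi> a + y_coef a * euler_x (\<Psi> a))"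
    by (simp add: euler_x_euler_y euler_x_sum euler_x_mult)
  also have "\<dots> = (\<Sum>a\<in>alphA. euler_y (x_coef a) * \<Psi> a + x_coef a * euler_y (\<Psi> a)) -
      (\<Sum>a\<in>alphA. euler_x (y_coef a) * \<Psi> a + y_coef a * euler_x (\<Psi> a))"
    by (simp add: euler_x_\<Phi> euler_y_sum euler_y_mult)
  also have "\<dots> = (\<Sum>a\<in>alphA. x_coef a * euler_y (\<Psi> a) - y_coef a * euler_x (\<Psi> a))"
    by (simp add: sum_subtractf[symmetric] euler_y_x_coef cong: sum.cong)
  also have "\<dots> = (\<Sum>a\<in>alphA. \<Sum>b\<in>alphA. (x_coef a * y_coef b - y_coef a * x_coef b) * P a b)"
    by (simp add: IH[folded \<Psi>_def P_def] euler_x_\<Psi> sum_distrib_left sum_subtractf[symmetric]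
        algebra_simps)
  also have "\<dots> = (\<Sum>w\<in>words_upto n. (\<Sum>a\<in>alphA. \<Sum>b\<in>alphA.
      const2 (\<phi> ([] @ a # b # w)) * (x_coef a * y_coef b - y_coef a * x_coef b)) * K12 w)"
    by (simp add: P_def wsum_def lshift_def sum_distrib_left sum_distrib_right algebra_simps
        sum.swap[of _ "words_upto n"])
  also have "\<dots> = 0"
  proof (intro sum.neutral ballI)
    fix w
    have "wedge_rels \<phi> [] w"
      using G by (simp add: chen_reduced_def)
    thus "(\<Sum>a\<in>alphA. \<Sum>b\<in>alphA. const2 (\<phi> ([] @ a # b # w)) *
        (x_coef a * y_coef b - y_coef a * x_coef b)) * K12 w = 0"
      by (simp only: wedge_rels_formal mult_zero_left)
  qed
  finally show ?thesis
    by (simp add: \<Phi>_def \<Psi>_def)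
qed

lemma euler_y_wsum_K12:
  assumes "chen_reduced \<phi>" and "supp_within \<phi> n"
  shows "euler_y (wsum K12 n \<phi>) = (\<Sum>a\<in>alphA. y_coef a * wsum K12 n (lshift \<phi> a))"
  using assms
proof (induction n arbitrary: \<phi>)
  case 0
  thus ?case by (simp add: wsum_0 supp_within_0_lshift)
next
  case (Suc n \<phi>)
  have IH: "euler_y (wsum K12 n (lshift \<phi> a)) =
      (\<Sum>b\<in>alphA. y_coef b * wsum K12 n (lshift (lshift \<phi> a) b))" for a
    by (rule Suc.IH[OF chen_reduced_lshift[OF Suc.prems(1)] supp_within_lshift[OF Suc.prems(2)]])
  have "euler_y (wsum K12 (Suc n) \<phi>) - (\<Sum>a\<in>alphA. y_coef a * wsum K12 n (lshift \<phi> a)) = 0"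
  proof (rule euler_x_eq_0_imp_eq_0)
    show "euler_x (euler_y (wsum K12 (Suc n) \<phi>) - (\<Sum>a\<in>alphA. y_coef a * wsum K12 n (lshift \<phi> a))) = 0"
      by (rule euler_x_K12_defect[OF Suc.prems IH])
    show "(euler_y (wsum K12 (Suc n) \<phi>) - (\<Sum>a\<in>alphA. y_coef a * wsum K12 n (lshift \<phi> a))) $ 0 = 0"
      by (simp only: fps_sub_nth euler_y_wsum_K12_nth_0[OF Suc.prems(1)] diff_self)
  qed
  moreover have "wsum K12 (Suc n) (lshift \<phi> a) = wsum K12 n (lshift \<phi> a)" for a
    by (rule wsum_mono[OF supp_within_lshift[OF Suc.prems(2)]]) simp
  ultimately show ?case
    by simp
qed

text \<open>Both sides solve the same y-equation and agree on y = 0.\<close>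
theorem wsum_K12_eq_K21:
  assumes "chen_reduced \<phi>" and "supp_within \<phi> n"
  shows "wsum K12 n \<phi> = wsum K21 n \<phi>"
  using assms
proof (induction n arbitrary: \<phi>)
  case 0
  thus ?case by (simp add: wsum_0)
next
  case (Suc n \<phi>)
  have shifted: "wsum K12 (Suc n) (lshift \<phi> a) = wsum K21 (Suc n) (lshift \<phi> a)" for a
  proof -
    have B: "supp_within (lshift \<phi> a) n"
      by (rule supp_within_lshift[OF Suc.prems(2)])
    have "wsum K12 (Suc n) (lshift \<phi> a) = wsum K12 n (lshift \<phi> a)"
      by (rule wsum_mono[OF B]) simp
    also have "\<dots> = wsum K21 n (lshift \<phi> a)"
      by (rule Suc.IH[OF chen_reduced_lshift[OF Suc.prems(1)] B])
    also have "\<dots> = wsum K21 (Suc n) (lshift \<phi> a)"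
      by (rule wsum_mono[OF B, symmetric]) simp
    finally show ?thesis .
  qed
  define H where "H = wsum K12 (Suc n) \<phi> - wsum K21 (Suc n) \<phi>"
  have "euler_y H = 0"
    by (simp add: H_def euler_y_wsum_K12[OF Suc.prems] euler_y_wsum_K21[OF Suc.prems] shifted)
  moreover have "at_y0 H = 0"
    by (simp add: H_def wsum_def at_y0_sum at_y0_K12 at_y0_K21)
  ultimately have "H = 0"
    by (rule euler_y_eq_0_imp_eq_0)
  thus ?case
    by (simp add: H_def)
qed

section \<open>Chen's condition yields the wedge relations\<close>

lemma prod_diff_split_point:
  assumes "finite J" and "j0 \<in> J" and "j0 \<notin> J'" and "\<And>j. j \<noteq> j0 \<Longrightarrow> g' j = g j"
  shows "(\<Prod>j\<in>J - J'. g' j) = g' j0 * (\<Prod>j\<in>J - insert j0 J'. g j)"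
proof -
  have "J - J' = insert j0 (J - insert j0 J')"
    using assms(2,3) by auto
  hence "(\<Prod>j\<in>J - J'. g' j) = (\<Prod>j\<in>insert j0 (J - insert j0 J'). g' j)"
    by (simp only:)
  also have "\<dots> = g' j0 * (\<Prod>j\<in>J - insert j0 J'. g' j)"
    by (rule prod.insert) (use assms(1) in auto)
  also have "(\<Prod>j\<in>J - insert j0 J'. g' j) = (\<Prod>j\<in>J - insert j0 J'. g j)"
    by (rule prod.cong) (use assms(4) in auto)
  finally show ?thesis .
qed

lemma sum_dual_select:
  fixes G :: "form list \<Rightarrow> complex"
  assumes "finite V" and "\<And>w. w \<in> V \<Longrightarrow> w ! j0 \<in> alphA"
    and dual: "\<And>a. a \<in> alphA \<Longrightarrow> (\<Sum>i<N. \<mu> i * coef a (k i) (pt i)) = (if a = e then 1 else 0)"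
  shows "(\<Sum>i<N. \<mu> i * (\<Sum>w\<in>V. G w * coef (w ! j0) (k i) (pt i))) = (\<Sum>w\<in>{w\<in>V. w ! j0 = e}. G w)"
proof -
  have "(\<Sum>i<N. \<mu> i * (\<Sum>w\<in>V. G w * coef (w ! j0) (k i) (pt i))) =
      (\<Sum>w\<in>V. G w * (\<Sum>i<N. \<mu> i * coef (w ! j0) (k i) (pt i)))"
    by (simp add: sum_distrib_left sum_distrib_right mult_ac sum.swap[of _ "{..<N}"])
  also have "\<dots> = (\<Sum>w\<in>V. if w ! j0 = e then G w else 0)"
    by (rule sum.cong) (use assms(2) dual in auto)
  also have "\<dots> = (\<Sum>w\<in>{w\<in>V. w ! j0 = e}. G w)"
    using assms(1) by (simp add: sum.inter_filter)
  finally show ?thesis .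
qed

text \<open>Evaluating the slot j0 at the sample points pt i (component k i) and averaging with the
  weights \<mu> (t ! j0) selects the words having the letter t ! j0 there; repeating this for every slot
  in J' fixes those letters.\<close>
lemma chen_sum_fix_letters:
  fixes c :: "form list \<Rightarrow> complex" and \<Psi> :: "form list \<Rightarrow> complex \<times> complex \<Rightarrow> complex"
    and \<mu> :: "form \<Rightarrow> nat \<Rightarrow> complex" and k :: "nat \<Rightarrow> bool" and pt :: "nat \<Rightarrow> complex \<times> complex"
  assumes finW: "finite W" and finJ: "finite J" and mJ: "m \<notin> J"
    and alph: "\<And>w j. w \<in> W \<Longrightarrow> j \<in> J \<Longrightarrow> w ! j \<in> alphA"
    and talph: "\<And>j. j \<in> J \<Longrightarrow> t ! j \<in> alphA"
    and dual: "\<And>e a. e \<in> alphA \<Longrightarrow> a \<in> alphA \<Longrightarrow>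
      (\<Sum>i<N. \<mu> e i * coef a (k i) (pt i)) = (if a = e then 1 else 0)"
    and pt_dom: "\<And>i. pt i \<in> dom2"
    and H: "\<And>ks ps. (\<forall>j. ps j \<in> dom2) \<Longrightarrow>
        (\<Sum>w\<in>W. c w * \<Psi> w (ps m) * (\<Prod>j\<in>J. coef (w ! j) (ks j) (ps j))) = 0"
  shows "J' \<subseteq> J \<Longrightarrow> (\<forall>j. ps j \<in> dom2) \<Longrightarrow>
     (\<Sum>w\<in>{w\<in>W. \<forall>j\<in>J'. w ! j = t ! j}. c w * \<Psi> w (ps m) * (\<Prod>j\<in>J - J'. coef (w ! j) (ks j) (ps j))) = 0"
proof (induction J' arbitrary: ks ps rule: infinite_finite_induct)
  case (infinite A)
  thus ?case using finJ by (meson finite_subset)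
next
  case empty
  thus ?case using H by simp
next
  case (insert j0 J' ks ps)
  have j0: "j0 \<in> J" and J': "J' \<subseteq> J"
    using insert.prems by auto
  define V where "V = {w\<in>W. \<forall>j\<in>J'. w ! j = t ! j}"
  define G where "G w = c w * \<Psi> w (ps m) * (\<Prod>j\<in>J - insert j0 J'. coef (w ! j) (ks j) (ps j))" for w
  have split: "(\<Prod>j\<in>J - J'. coef (w ! j) ((ks(j0 := k i)) j) ((ps(j0 := pt i)) j)) =
      coef (w ! j0) (k i) (pt i) * (\<Prod>j\<in>J - insert j0 J'. coef (w ! j) (ks j) (ps j))" for w i
    using prod_diff_split_point[OF finJ j0 insert.hyps(2),
        of "\<lambda>j. coef (w ! j) ((ks(j0 := k i)) j) ((ps(j0 := pt i)) j)" "\<lambda>j. coef (w ! j) (ks j) (ps j)"]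
    by simp
  have "(\<Sum>w\<in>V. G w * coef (w ! j0) (k i) (pt i)) = 0" for i
  proof -
    have "(\<Sum>w\<in>V. c w * \<Psi> w ((ps(j0 := pt i)) m) *
        (\<Prod>j\<in>J - J'. coef (w ! j) ((ks(j0 := k i)) j) ((ps(j0 := pt i)) j))) = 0"
      unfolding V_def by (rule insert.IH) (use J' insert.prems pt_dom in auto)
    moreover have "(ps(j0 := pt i)) m = ps m"
      using mJ j0 by auto
    ultimately show ?thesis
      by (simp only: split) (simp add: G_def mult_ac)
  qed
  hence "(\<Sum>i<N. \<mu> (t ! j0) i * (\<Sum>w\<in>V. G w * coef (w ! j0) (k i) (pt i))) = 0"
    by simp
  moreover have "{w\<in>V. w ! j0 = t ! j0} = {w\<in>W. \<forall>j\<in>insert j0 J'. w ! j = t ! j}"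
    by (auto simp: V_def)
  ultimately show ?case
    using sum_dual_select[where V=V and G=G and \<mu>="\<mu> (t ! j0)" and e="t ! j0"] finW alph j0 dual talph
    by (simp add: V_def G_def)
qed

lemma nth_append_pair_other:
  "j \<noteq> length p \<Longrightarrow> j \<noteq> Suc (length p) \<Longrightarrow> (p @ a # b # q) ! j = (p @ x # y # q) ! j"
proof (cases "j < length p")
  case False
  assume "j \<noteq> length p" "j \<noteq> Suc (length p)"
  with False obtain k where "j = length p + Suc (Suc k)"
    by (metis add_Suc_right less_Suc_eq less_imp_Suc_add not_less_eq)
  thus ?thesis by (simp add: nth_append)
qed (simp add: nth_append)

lemma eq_append_pair_if_nth_eq:
  assumes "length w = length p + 2 + length q"
    and "\<And>j. j < length w \<Longrightarrow> j \<noteq> length p \<Longrightarrow> j \<noteq> Suc (length p) \<Longrightarrow> w ! j = (p @ x # y # q) ! j"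
  shows "w = p @ w ! length p # w ! Suc (length p) # q"
proof (rule nth_equalityI)
  show "length w = length (p @ w ! length p # w ! Suc (length p) # q)"
    using assms(1) by simp
  fix j assume "j < length w"
  show "w ! j = (p @ w ! length p # w ! Suc (length p) # q) ! j"
  proof (cases "j = length p \<or> j = Suc (length p)")
    case True
    thus ?thesis by (auto simp: nth_append)
  next
    case False
    hence "w ! j = (p @ x # y # q) ! j"
      using assms(2)[OF \<open>j < length w\<close>] by blast
    also have "\<dots> = (p @ w ! length p # w ! Suc (length p) # q) ! j"
      by (rule nth_append_pair_other) (use False in auto)
    finally show ?thesis .
  qed
qed

text \<open>Five evaluations of components of 1-forms (dz1 at the first three sample points, dz2 at the
  last two) that separate the letters of A: dual_weights e combines them into the coefficient of
  the letter e.\<close>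
definition dual_component :: "nat \<Rightarrow> bool" where
  "dual_component i = (3 \<le> i)"

definition dual_point :: "nat \<Rightarrow> complex \<times> complex" where
  "dual_point i = (if i = 0 then (-1, 2) else if i = 1 then (2, 2) else if i = 2 then (-1, -2)
                   else if i = 3 then (-1, 3) else (2, 2))"

fun dual_weights :: "form \<Rightarrow> complex list" where
  "dual_weights zeta1 = [-5/3, -2/3, 1/3, 0, 0]"
| "dual_weights zeta11 = [-1/3, -4/3, -1/3, 0, 0]"
| "dual_weights zeta2 = [3/4, 0, -3/4, 12, -6]"
| "dual_weights zeta22 = [7/8, 0, -7/8, 6, -4]"
| "dual_weights zeta12 = [-3/4, 0, 3/4, 0, 0]"
| "dual_weights _ = [0, 0, 0, 0, 0]"

lemma dual_point_in_dom2: "dual_point i \<in> dom2"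
  by (auto simp: dual_point_def dom2_def)

lemma dual_weights_coef:
  assumes "e \<in> alphA" and "a \<in> alphA"
  shows "(\<Sum>i<5. dual_weights e ! i * coef a (dual_component i) (dual_point i)) = (if a = e then 1 else 0)"
proof -
  have "(\<Sum>i<(5::nat). f i) = f 0 + f 1 + f 2 + f 3 + (f 4 :: complex)" for f
    by (simp add: numeral_eq_Suc)
  thus ?thesis
    using assms by (auto simp: alphA_def dual_component_def dual_point_def)
qed

lemma sum_agreeing_outside_pair:
  fixes c :: "form list \<Rightarrow> complex" and F :: "form \<Rightarrow> form \<Rightarrow> complex" and p q :: "form list"
  defines "J \<equiv> {0..<length p + 2 + length q} - {length p, Suc (length p)}"
  assumes c: "\<And>w. c w \<noteq> 0 \<Longrightarrow> set w \<subseteq> alphA \<and> length w = length p + 2 + length q"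
  shows "(\<Sum>w\<in>{w. c w \<noteq> 0 \<and> (\<forall>j\<in>J. w ! j = (p @ u # v # q) ! j)}.
            c w * F (w ! length p) (w ! Suc (length p))) =
         (\<Sum>a\<in>alphA. \<Sum>b\<in>alphA. c (p @ a # b # q) * F a b)"
proof -
  define S where "S = {w. c w \<noteq> 0 \<and> (\<forall>j\<in>J. w ! j = (p @ u # v # q) ! j)}"
  define f where "f = (\<lambda>(a, b). p @ a # b # q)"
  have S_sub: "S \<subseteq> f ` (alphA \<times> alphA)"
  proof
    fix w assume "w \<in> S"
    hence w: "c w \<noteq> 0" "\<And>j. j \<in> J \<Longrightarrow> w ! j = (p @ u # v # q) ! j"
      by (auto simp: S_def)
    have "w = p @ w ! length p # w ! Suc (length p) # q"
      by (rule eq_append_pair_if_nth_eq) (use w c in \<open>auto simp: J_def\<close>)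
    moreover have "w ! length p \<in> alphA" "w ! Suc (length p) \<in> alphA"
      using c[OF w(1)] nth_mem[of "length p" w] nth_mem[of "Suc (length p)" w] by auto
    ultimately show "w \<in> f ` (alphA \<times> alphA)"
      by (auto simp: f_def image_def)
  qed
  have outside_S: "c w = 0" if wS: "w \<in> f ` (alphA \<times> alphA) - S" for w
  proof -
    obtain a b where w: "w = p @ a # b # q"
      using wS by (auto simp: f_def)
    have "\<forall>j\<in>J. w ! j = (p @ u # v # q) ! j"
      unfolding w by (auto simp: J_def intro: nth_append_pair_other)
    thus ?thesis
      using wS by (auto simp: S_def)
  qed
  have "(\<Sum>w\<in>S. c w * F (w ! length p) (w ! Suc (length p))) =
      (\<Sum>w\<in>f ` (alphA \<times> alphA). c w * F (w ! length p) (w ! Suc (length p)))"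
    by (rule sum.mono_neutral_left) (use S_sub outside_S in auto)
  also have "\<dots> = (\<Sum>(a, b)\<in>alphA \<times> alphA. c (p @ a # b # q) * F a b)"
    by (rule sum.reindex_cong[where l=f]) (auto simp: inj_on_def f_def nth_append)
  finally show ?thesis
    by (simp add: S_def sum.cartesian_product)
qed

lemma barB_wedge_sum_eq_0:
  assumes B: "\<phi> \<in> barB" and "set p \<subseteq> alphA" and "set q \<subseteq> alphA" and "x \<in> dom2"
  shows "(\<Sum>a\<in>alphA. \<Sum>b\<in>alphA. \<phi> (p @ a # b # q) * wedge_coef a b x) = 0"
proof -
  define s where "s = length p + 2 + length q"
  define m where "m = length p"
  define c where "c = (\<lambda>w. if length w = s then \<phi> w else 0)"
  define W where "W = {w. c w \<noteq> 0 \<and> length w = s}"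
  define J where "J = {0..<s} - {m, Suc m}"
  define t where "t = p @ zeta1 # zeta1 # q"
  define \<Psi> where "\<Psi> w x = wedge_coef (w ! m) (w ! Suc m) x" for w x
  have fin: "finite (supp \<phi>)" and letters: "\<And>w. w \<in> supp \<phi> \<Longrightarrow> set w \<subseteq> alphA"
    using B by (auto simp: barB_def)
  have W_supp: "W \<subseteq> supp \<phi>"
    by (auto simp: W_def c_def supp_def split: if_splits)
  have chen: "(\<Sum>w\<in>W. c w * \<Psi> w (ps m) * (\<Prod>j\<in>J. coef (w ! j) (ks j) (ps j))) = 0"
    if "\<forall>j. ps j \<in> dom2" for ks ps
  proof -
    have "chen_hom s c"
      using B by (simp add: barB_def c_def)
    moreover have "Suc m < s"
      by (simp add: s_def m_def)
    ultimately show ?thesis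
      using that unfolding chen_hom_def W_def J_def \<Psi>_def by blast
  qed
  have W_letters: "w ! j \<in> alphA" if "w \<in> W" "j \<in> J" for w j
    using that W_supp letters by (fastforce simp: W_def J_def)
  have t_letters: "t ! j \<in> alphA" if "j \<in> J" for j
    using that assms(2,3) by (force simp: t_def J_def s_def nth_append nth_Cons split: nat.splits)
  have "(\<Sum>w\<in>{w\<in>W. \<forall>j\<in>J. w ! j = t ! j}. c w * \<Psi> w x) = 0"
    using chen_sum_fix_letters[OF finite_subset[OF W_supp fin] _ _ W_letters t_letters
        dual_weights_coef dual_point_in_dom2 chen, of J "\<lambda>_. x" undefined]
    by (simp add: J_def assms(4))
  moreover have "{w\<in>W. \<forall>j\<in>J. w ! j = t ! j} = {w. c w \<noteq> 0 \<and> (\<forall>j\<in>J. w ! j = t ! j)}"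
    by (auto simp: W_def c_def split: if_splits)
  moreover have "(\<Sum>w\<in>{w. c w \<noteq> 0 \<and> (\<forall>j\<in>J. w ! j = t ! j)}. c w * \<Psi> w x) =
      (\<Sum>a\<in>alphA. \<Sum>b\<in>alphA. c (p @ a # b # q) * wedge_coef a b x)"
    unfolding J_def s_def m_def t_def \<Psi>_def
    by (rule sum_agreeing_outside_pair) (use letters in \<open>auto simp: c_def s_def supp_def split: if_splits\<close>)
  ultimately show ?thesis
    by (simp add: c_def s_def)
qed

text \<open>The coefficients invert the linear system given by the six sample points.\<close>
lemma wedge_rels_if_wedge_sums_vanish:
  fixes c :: "form \<Rightarrow> form \<Rightarrow> complex"
  assumes vanish: "\<And>x. x \<in> dom2 \<Longrightarrow> (\<Sum>a\<in>alphA. \<Sum>b\<in>alphA. c a b * wedge_coef a b x) = 0"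
  defines "d a b \<equiv> c a b - c b a"
  shows "d zeta1 zeta2 = 0 \<and> d zeta1 zeta22 = 0 \<and> d zeta11 zeta2 = 0 \<and>
    d zeta1 zeta12 - d zeta2 zeta12 + d zeta11 zeta22 = 0 \<and>
    d zeta11 zeta12 + d zeta11 zeta22 = 0 \<and> d zeta11 zeta22 - d zeta22 zeta12 = 0"
proof -
  define S where "S x y = (\<Sum>a\<in>alphA. \<Sum>b\<in>alphA. c a b * wedge_coef a b (x, y))" for x y :: complex
  have "S (-1) 2 = 0" "S 2 2 = 0" "S (-1) (-2) = 0" "S (-1) 3 = 0" "S 2 3 = 0" "S 3 (-1) = 0"
    using vanish by (simp_all add: S_def dom2_def)
  moreover have "d zeta1 zeta2 =
      (168/11) * S (-1) 2 + (-84/11) * S 2 2 + (-144/55) * S (-1) (-2)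
      + (-1816/55) * S (-1) 3 + (200/11) * S 2 3 + (72/11) * S 3 (-1)"
    by (simp add: d_def S_def alphA_def wedge_coef_def field_simps)
  moreover have "d zeta1 zeta22 =
      (54/11) * S (-1) 2 + (72/11) * S 2 2 + (-18/55) * S (-1) (-2)
      + (-392/55) * S (-1) 3 + (-140/11) * S 2 3 + (-24/11) * S 3 (-1)"
    by (simp add: d_def S_def alphA_def wedge_coef_def field_simps)
  moreover have "d zeta11 zeta2 =
      (138/11) * S (-1) 2 + (-168/11) * S 2 2 + (-18/11) * S (-1) (-2)
      + (-304/11) * S (-1) 3 + (400/11) * S 2 3 + (144/11) * S 3 (-1)"
    by (simp add: d_def S_def alphA_def wedge_coef_def field_simps)
  moreover have "d zeta1 zeta12 - d zeta2 zeta12 + d zeta11 zeta22 =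
      (98/11) * S (-1) 2 + (-16/11) * S 2 2 + (-30/11) * S (-1) (-2)
      + (-206/11) * S (-1) 3 + (80/11) * S 2 3 + (42/11) * S 3 (-1)"
    by (simp add: d_def S_def alphA_def wedge_coef_def field_simps)
  moreover have "d zeta11 zeta12 + d zeta11 zeta22 =
      (11) * S (-1) 2 + (-16) * S 2 2 + (-9/5) * S (-1) (-2)
      + (-116/5) * S (-1) 3 + (40) * S 2 3 + (12) * S 3 (-1)"
    by (simp add: d_def S_def alphA_def wedge_coef_def field_simps)
  moreover have "d zeta11 zeta22 - d zeta22 zeta12 =
      (9/11) * S (-1) 2 + (144/11) * S 2 2 + (-3/55) * S (-1) (-2)
      + (8/55) * S (-1) 3 + (-280/11) * S 2 3 + (-48/11) * S 3 (-1)"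
    by (simp add: d_def S_def alphA_def wedge_coef_def field_simps)
  ultimately show ?thesis
    by simp
qed

lemma barB0_chen_reduced:
  assumes "\<phi> \<in> barB0"
  shows "chen_reduced \<phi>"
  unfolding chen_reduced_def
proof (intro conjI allI)
  have B: "\<phi> \<in> barB" and last_letter: "\<forall>w\<in>supp \<phi>. w = [] \<or> last w \<notin> {zeta1, zeta2}"
    using assms by (auto simp: barB0_def)
  fix p
  show "\<phi> (p @ [zeta1]) = 0" "\<phi> (p @ [zeta2]) = 0"
    using last_letter by (auto simp: supp_def)
  fix q
  show "wedge_rels \<phi> p q"
  proof (cases "set p \<subseteq> alphA \<and> set q \<subseteq> alphA")
    case True
    show ?thesis
      unfolding wedge_rels_def Let_def
      by (rule wedge_rels_if_wedge_sums_vanish[of "\<lambda>a b. \<phi> (p @ a # b # q)"])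
        (use barB_wedge_sum_eq_0[OF B] True in blast)
  next
    case False
    have "\<phi> (p @ a # b # q) = 0" for a b
      using B False by (fastforce simp: barB_def supp_def)
    thus ?thesis
      by (simp add: wedge_rels_def)
  qed
qed

lemma barB0_supp_within:
  assumes "\<phi> \<in> barB0"
  obtains n where "supp_within \<phi> n"
proof
  have fin: "finite (supp \<phi>)" and letters: "\<And>w. \<phi> w \<noteq> 0 \<Longrightarrow> set w \<subseteq> alphA"
    using assms by (auto simp: barB0_def barB_def supp_def)
  have "length w \<le> Max (insert 0 (length ` supp \<phi>))" if "\<phi> w \<noteq> 0" for w
    using fin that by (intro Max_ge) (auto simp: supp_def)
  thus "supp_within \<phi> (Max (insert 0 (length ` supp \<phi>)))"
    using letters by (auto simp: supp_within_def)
qed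

section \<open>Evaluation on the unit polydisc\<close>

lemma conv_radius_ge_1_if_bounded:
  fixes f :: "complex fps"
  assumes "\<And>n. norm (f $ n) \<le> M"
  shows "1 \<le> fps_conv_radius f"
  unfolding fps_conv_radius_def
proof (rule conv_radius_geI_ex')
  fix r :: real assume r: "0 < r" "ereal r < 1"
  hence r1: "r < 1" by simp
  have "summable (\<lambda>n. M * r ^ n)" using r r1 by (intro summable_mult summable_geometric) auto
  thus "summable (\<lambda>n. f $ n * of_real r ^ n)"
  proof (rule summable_comparison_test'[where N=0])
    fix n :: nat
    have "norm (f $ n * of_real r ^ n) = norm (f $ n) * r ^ n"
      using r by (simp add: norm_mult norm_power)
    also have "\<dots> \<le> M * r ^ n" using assms r by (intro mult_right_mono) auto
    finally show "norm (f $ n * of_real r ^ n) \<le> M * r ^ n" .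
  qed
qed

lemma norm_eval_fps_le:
  fixes f :: "complex fps"
  assumes "\<And>n. norm (f $ n) \<le> M" "norm y < 1"
  shows "norm (eval_fps f y) \<le> M / (1 - norm y)"
proof -
  have sg: "summable (\<lambda>n. M * norm y ^ n)" using assms(2) by (intro summable_mult summable_geometric) auto
  have le: "norm (f $ n * y ^ n) \<le> M * norm y ^ n" for n
    using assms(1)[of n] by (simp add: norm_mult norm_power mult_right_mono)
  have sn: "summable (\<lambda>n. norm (f $ n * y ^ n))"
    by (rule summable_comparison_test'[OF sg]) (use le in auto)
  have "norm (eval_fps f y) \<le> (\<Sum>n. norm (f $ n * y ^ n))"
    unfolding eval_fps_def by (rule summable_norm[OF sn])
  also have "\<dots> \<le> (\<Sum>n. M * norm y ^ n)" by (rule suminf_le[OF le sn sg])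
  also have "\<dots> = M / (1 - norm y)"
    using assms(2) by (simp add: suminf_mult suminf_geometric divide_simps)
  finally show ?thesis .
qed

definition eval_y :: "fps2 \<Rightarrow> complex \<Rightarrow> complex fps" where
  "eval_y P y = Abs_fps (\<lambda>i. eval_fps (P $ i) y)"

definition eval2 :: "fps2 \<Rightarrow> complex \<Rightarrow> complex \<Rightarrow> complex" where
  "eval2 P x y = eval_fps (eval_y P y) x"

definition coeffs_bounded :: "real \<Rightarrow> fps2 \<Rightarrow> bool" where
  "coeffs_bounded M P \<longleftrightarrow> (\<forall>i j. norm (P $ i $ j) \<le> M)"

definition unit_conv :: "fps2 \<Rightarrow> bool" where
  "unit_conv P \<longleftrightarrow>
     (\<forall>i. 1 \<le> fps_conv_radius (P $ i)) \<and> (\<forall>y. norm y < 1 \<longrightarrow> 1 \<le> fps_conv_radius (eval_y P y))"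

lemma eval_y_nth [simp]: "eval_y P y $ i = eval_fps (P $ i) y"
  by (simp add: eval_y_def)

lemma unit_conv_nth: "unit_conv P \<Longrightarrow> 1 \<le> fps_conv_radius (P $ i)"
  by (simp add: unit_conv_def)

lemma unit_conv_eval_y: "unit_conv P \<Longrightarrow> norm y < 1 \<Longrightarrow> 1 \<le> fps_conv_radius (eval_y P y)"
  by (simp add: unit_conv_def)

lemma coeffs_bounded_imp_unit_conv:
  assumes "coeffs_bounded M P"
  shows "unit_conv P"
  unfolding unit_conv_def
proof (intro conjI allI impI)
  show "1 \<le> fps_conv_radius (P $ i)" for i
    using assms by (intro conv_radius_ge_1_if_bounded[of _ M]) (simp add: coeffs_bounded_def)
  show "1 \<le> fps_conv_radius (eval_y P y)" if "norm y < 1" for y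
    using assms that
    by (intro conv_radius_ge_1_if_bounded[of _ "M / (1 - norm y)"])
      (auto simp: coeffs_bounded_def intro!: norm_eval_fps_le)
qed

lemma ereal_norm_less: "norm (y :: complex) < 1 \<Longrightarrow> 1 \<le> r \<Longrightarrow> ereal (norm y) < r"
  by (metis ereal_less(3) less_le_trans one_ereal_def)

lemma conv_radius_add_ge_1:
  "1 \<le> fps_conv_radius f \<Longrightarrow> 1 \<le> fps_conv_radius g \<Longrightarrow> 1 \<le> fps_conv_radius (f + g :: complex fps)"
  using fps_conv_radius_add[of f g] by (auto simp: min_def split: if_splits)

lemma conv_radius_mult_ge_1:
  "1 \<le> fps_conv_radius f \<Longrightarrow> 1 \<le> fps_conv_radius g \<Longrightarrow> 1 \<le> fps_conv_radius (f * g :: complex fps)"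
  using fps_conv_radius_mult[of f g] by (auto simp: min_def split: if_splits)

lemma conv_radius_sum_ge_1:
  "(\<And>x. x \<in> S \<Longrightarrow> 1 \<le> fps_conv_radius (f x :: complex fps)) \<Longrightarrow> 1 \<le> fps_conv_radius (sum f S)"
  by (induction S rule: infinite_finite_induct) (auto intro: conv_radius_add_ge_1)

lemma eval_fps_sum:
  assumes "\<And>x. x \<in> S \<Longrightarrow> 1 \<le> fps_conv_radius (f x :: complex fps)" and "norm y < 1"
  shows "eval_fps (sum f S) y = (\<Sum>x\<in>S. eval_fps (f x) y)"
  using assms(1)
proof (induction S rule: infinite_finite_induct)
  case (insert a S)
  have "eval_fps (f a + sum f S) y = eval_fps (f a) y + eval_fps (sum f S) y"
    by (rule eval_fps_add) (use insert conv_radius_sum_ge_1[of S f] assms(2) in \<open>auto intro: ereal_norm_less\<close>)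
  thus ?case
    using insert by simp
qed simp_all

lemma eval_y_mult:
  assumes "unit_conv P" and "unit_conv Q" and "norm y < 1"
  shows "eval_y (P * Q) y = eval_y P y * eval_y Q y"
proof (rule fps_ext)
  fix i
  have "eval_y (P * Q) y $ i = eval_fps (\<Sum>k=0..i. P $ k * Q $ (i - k)) y"
    by (simp add: fps_mult_nth)
  also have "\<dots> = (\<Sum>k=0..i. eval_fps (P $ k * Q $ (i - k)) y)"
    by (rule eval_fps_sum) (use assms in \<open>auto intro: conv_radius_mult_ge_1 unit_conv_nth\<close>)
  also have "\<dots> = (\<Sum>k=0..i. eval_fps (P $ k) y * eval_fps (Q $ (i - k)) y)"
    by (intro sum.cong refl eval_fps_mult) (use assms in \<open>auto intro: ereal_norm_less unit_conv_nth\<close>)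
  finally show "eval_y (P * Q) y $ i = (eval_y P y * eval_y Q y) $ i"
    by (simp add: fps_mult_nth)
qed

lemma eval_y_add:
  assumes "unit_conv P" and "unit_conv Q" and "norm y < 1"
  shows "eval_y (P + Q) y = eval_y P y + eval_y Q y"
  by (rule fps_ext) (use assms in \<open>auto intro!: eval_fps_add ereal_norm_less unit_conv_nth\<close>)

lemma unit_conv_mult:
  assumes "unit_conv P" and "unit_conv Q"
  shows "unit_conv (P * Q)"
  unfolding unit_conv_def
proof (intro conjI allI impI)
  show "1 \<le> fps_conv_radius ((P * Q) $ i)" for i
    unfolding fps_mult_nth
    by (rule conv_radius_sum_ge_1) (use assms in \<open>auto intro: conv_radius_mult_ge_1 unit_conv_nth\<close>)
  show "1 \<le> fps_conv_radius (eval_y (P * Q) y)" if "norm y < 1" for y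
    using assms that by (simp add: eval_y_mult conv_radius_mult_ge_1 unit_conv_eval_y)
qed

lemma unit_conv_add:
  assumes "unit_conv P" and "unit_conv Q"
  shows "unit_conv (P + Q)"
  unfolding unit_conv_def
proof (intro conjI allI impI)
  show "1 \<le> fps_conv_radius ((P + Q) $ i)" for i
    using assms by (simp add: conv_radius_add_ge_1 unit_conv_nth)
  show "1 \<le> fps_conv_radius (eval_y (P + Q) y)" if "norm y < 1" for y
    using assms that by (simp add: eval_y_add conv_radius_add_ge_1 unit_conv_eval_y)
qed

lemma eval_y_0 [simp]: "eval_y 0 y = 0"
  by (rule fps_ext) simp

lemma eval2_0 [simp]: "eval2 0 x y = 0"
  by (simp add: eval2_def)

lemma unit_conv_0: "unit_conv 0"
  by (simp add: unit_conv_def)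

lemma unit_conv_sum: "(\<And>x. x \<in> S \<Longrightarrow> unit_conv (f x)) \<Longrightarrow> unit_conv (sum f S)"
  by (induction S rule: infinite_finite_induct) (auto intro: unit_conv_add unit_conv_0)

lemma unit_conv_const2: "unit_conv (const2 c)"
  by (rule coeffs_bounded_imp_unit_conv[of "norm c"]) (auto simp: coeffs_bounded_def const2_def)

lemma eval2_mult:
  "unit_conv P \<Longrightarrow> unit_conv Q \<Longrightarrow> norm x < 1 \<Longrightarrow> norm y < 1 \<Longrightarrow> eval2 (P * Q) x y = eval2 P x y * eval2 Q x y"
  unfolding eval2_def by (simp add: eval_y_mult eval_fps_mult ereal_norm_less unit_conv_eval_y)

lemma eval2_add:
  "unit_conv P \<Longrightarrow> unit_conv Q \<Longrightarrow> norm x < 1 \<Longrightarrow> norm y < 1 \<Longrightarrow> eval2 (P + Q) x y = eval2 P x y + eval2 Q x y"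
  unfolding eval2_def by (simp add: eval_y_add eval_fps_add ereal_norm_less unit_conv_eval_y)

lemma eval2_sum:
  assumes "\<And>z. z \<in> S \<Longrightarrow> unit_conv (f z)" and "norm x < 1" and "norm y < 1"
  shows "eval2 (sum f S) x y = (\<Sum>z\<in>S. eval2 (f z) x y)"
  using assms(1)
  by (induction S rule: infinite_finite_induct) (auto simp: eval2_add unit_conv_sum assms(2,3))

lemma eval2_const2 [simp]: "eval2 (const2 c) x y = c"
proof -
  have "eval_y (const2 c) y = fps_const c"
    by (rule fps_ext) (simp add: const2_def)
  thus ?thesis
    by (simp add: eval2_def)
qed

lemma norm_sum_le_of_nat:
  fixes f :: "nat \<Rightarrow> complex"
  assumes "\<And>k. k \<in> {0..i} \<Longrightarrow> norm (f k) \<le> (if k = 0 then 0 else 1)"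
  shows "norm (\<Sum>k=0..i. f k) \<le> real i"
proof -
  have "norm (\<Sum>k=0..i. f k) \<le> (\<Sum>k=0..i. norm (f k))" by (rule norm_sum)
  also have "\<dots> \<le> (\<Sum>k=0..i. (if k = 0 then 0 else 1::real))" by (rule sum_mono) (rule assms)
  also have "\<dots> = (\<Sum>k\<in>{1..i}. 1::real)"
    by (rule sum.mono_neutral_cong_right) auto
  also have "\<dots> = real i" by simp
  finally show ?thesis .
qed

lemma norm_mult_nth_le:
  assumes Q0: "Q $ 0 = 0"
    and Qk: "\<And>k p j. 0 < k \<Longrightarrow> (\<forall>j. norm (p $ j) \<le> 1) \<Longrightarrow> norm ((Q $ k * p) $ j) \<le> (1::real)"
    and P: "coeffs_bounded 1 P"
  shows "norm ((Q * P) $ i $ j) \<le> real i"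
proof -
  have "(Q * P) $ i $ j = (\<Sum>k=0..i. (Q $ k * P $ (i - k)) $ j)" by (simp add: fps_mult_nth fps_sum_nth)
  also have "norm \<dots> \<le> real i"
  proof (rule norm_sum_le_of_nat)
    fix k assume "k \<in> {0..i}"
    show "norm ((Q $ k * P $ (i - k)) $ j) \<le> (if k = 0 then 0 else 1)"
    proof (cases "k = 0")
      case False
      thus ?thesis using Qk[of k "P $ (i - k)" j] P by (auto simp: coeffs_bounded_def)
    qed (simp add: Q0)
  qed
  finally show ?thesis .
qed

lemma coeffs_bounded_prim_x:
  assumes "\<And>i j. 0 < i \<Longrightarrow> norm (R $ i $ j) \<le> real i"
  shows "coeffs_bounded 1 (prim_x R)"
  unfolding coeffs_bounded_def
proof (intro allI)
  fix i j
  show "norm (prim_x R $ i $ j) \<le> 1"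
  proof (cases "i = 0")
    case False
    have "norm (prim_x R $ i $ j) = norm (R $ i $ j) / real i" using False by (simp add: norm_divide)
    also have "\<dots> \<le> 1" using assms[of i j] False by (simp add: divide_simps)
    finally show ?thesis .
  qed simp
qed

text \<open>Multiplying by x_coef a costs at most a factor i on the coefficient of x^i (its constant term
  vanishes unless a = zeta1, and its coefficients are bounded by 1), and prim_x divides it out again.\<close>
lemma coeffs_bounded_L1_fps: "coeffs_bounded 1 (L1_fps u)"
proof (induction u)
  case Nil thus ?case by (simp add: coeffs_bounded_def fps_one_nth)
next
  case (Cons a u)
  note P = Cons.IH
  have R: "norm ((x_coef a * L1_fps u) $ i $ j) \<le> real i" if "0 < i" for i j
  proof (cases a)
    case zeta1
    thus ?thesis using P that by (auto simp: coeffs_bounded_def intro: order.trans[of _ 1])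
  next
    case zeta11
    have "norm ((geom_x * L1_fps u) $ i $ j) \<le> real i"
      by (rule norm_mult_nth_le[OF _ _ P]) auto
    thus ?thesis using zeta11 by simp
  next
    case zeta12
    have "norm ((geom_xy * L1_fps u) $ i $ j) \<le> real i"
      by (rule norm_mult_nth_le[OF _ _ P]) (auto simp: fps_X_power_mult_nth)
    thus ?thesis using zeta12 by simp
  next
    case zeta12_1
    have "norm ((geom_xy * L1_fps u) $ i $ j) \<le> real i"
      by (rule norm_mult_nth_le[OF _ _ P]) (auto simp: fps_X_power_mult_nth)
    thus ?thesis using zeta12_1 by simp
  qed simp_all
  show ?case by (simp add: coeffs_bounded_prim_x R del: prim_x_nth)
qed

lemma coeffs_bounded_swap_vars: "coeffs_bounded M P \<Longrightarrow> coeffs_bounded M (swap_vars P)"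
  by (simp add: coeffs_bounded_def)

lemma coeffs_bounded_L2_fps: "coeffs_bounded 1 (L2_fps u)"
  unfolding L2_fps_def by (rule coeffs_bounded_swap_vars[OF coeffs_bounded_L1_fps])

lemma unit_conv_L1_fps: "unit_conv (L1_fps u)"
  by (rule coeffs_bounded_imp_unit_conv[OF coeffs_bounded_L1_fps])

lemma unit_conv_L2_fps: "unit_conv (L2_fps u)"
  by (rule coeffs_bounded_imp_unit_conv[OF coeffs_bounded_L2_fps])

lemma unit_conv_x_coef: "unit_conv (x_coef a)"
proof -
  have "coeffs_bounded 1 (x_coef a)" by (cases a) (auto simp: coeffs_bounded_def fps_one_nth fps_X_power_nth)
  thus ?thesis by (rule coeffs_bounded_imp_unit_conv)
qed

lemma eval_fps_geometric:
  fixes z t :: complex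
  assumes "norm (z * t) < 1"
  shows "eval_fps (Abs_fps (\<lambda>n. if n = 0 then 0 else z ^ n)) t = z * t / (1 - z * t)"
proof -
  have g: "(\<lambda>n. (z * t) ^ n) sums (1 / (1 - z * t))" using geometric_sums[OF assms] .
  have s: "(\<lambda>n. if n = 0 then 1 else 0) sums (1::complex)"
    using sums_single[of 0 "\<lambda>_. 1::complex"] by simp
  have "(\<lambda>n. (z * t) ^ n - (if n = 0 then 1 else 0)) sums (1 / (1 - z * t) - 1)"
    by (rule sums_diff[OF g s])
  moreover have "(\<lambda>n. (z * t) ^ n - (if n = 0 then 1 else 0)) = (\<lambda>n. Abs_fps (\<lambda>n. if n = 0 then 0 else z ^ n) $ n * t ^ n)"
    by (auto simp: fun_eq_iff power_mult_distrib)
  ultimately have "(\<lambda>n. Abs_fps (\<lambda>n. if n = 0 then 0 else z ^ n) $ n * t ^ n) sums (1 / (1 - z * t) - 1)" by simp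
  hence "eval_fps (Abs_fps (\<lambda>n. if n = 0 then 0 else z ^ n)) t = 1 / (1 - z * t) - 1"
    unfolding eval_fps_def by (rule sums_unique[symmetric])
  also have "\<dots> = z * t / (1 - z * t)"
  proof -
    have "1 - z * t \<noteq> 0" using assms by (metis norm_one order_less_irrefl right_minus_eq)
    thus ?thesis by (simp add: field_simps)
  qed
  finally show ?thesis .
qed

lemma eval_y_1: "eval_y 1 y = 1"
  by (rule fps_ext) (simp add: fps_one_nth)

lemma eval_y_geom_x: "eval_y geom_x y = Abs_fps (\<lambda>n. if n = 0 then 0 else 1 ^ n)"
  by (rule fps_ext) simp

lemma eval_y_geom_xy: "eval_y geom_xy y = Abs_fps (\<lambda>n. if n = 0 then 0 else y ^ n)"
  by (rule fps_ext) simp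

lemma eval_fps_eval_y_x_coef:
  assumes "a \<in> {zeta1, zeta11, zeta12_1}" "t \<noteq> 0" "norm t < 1" "norm y < 1"
  shows "eval_fps (eval_y (x_coef a) y) t = t * coef a False (t, y)"
proof -
  have "norm y * norm t \<le> 1 * norm t" by (rule mult_right_mono) (use assms in auto)
  hence "norm y * norm t < 1" using assms(3) by linarith
  hence yt: "norm (y * t) < 1" by (simp add: norm_mult)
  have 1: "norm (1 * t) < 1" using assms by simp
  have d: "1 - t * y \<noteq> 0" using yt by (metis mult.commute norm_one order_less_irrefl right_minus_eq)
  have "a = zeta1 \<or> a = zeta11 \<or> a = zeta12_1" using assms(1) by auto
  moreover have ?thesis if "a = zeta1" using that assms by (simp add: eval_y_1)
  moreover have ?thesis if "a = zeta11" using that eval_fps_geometric[OF 1] assms by (simp add: eval_y_geom_x field_simps)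
  moreover have ?thesis if "a = zeta12_1" using that eval_fps_geometric[OF yt] d by (simp add: eval_y_geom_xy field_simps)
  ultimately show ?thesis by blast
qed

lemma eval_y_prim_x:
  assumes "unit_conv P" "norm y < 1"
  shows "eval_y (prim_x P) y = prim (eval_y P y)"
proof (rule fps_ext)
  fix i
  show "eval_y (prim_x P) y $ i = prim (eval_y P y) $ i"
  proof (cases "i = 0")
    case False
    have "eval_fps (fps_const (1 / of_nat i) * P $ i) y = (1 / of_nat i) * eval_fps (P $ i) y"
      by (subst eval_fps_mult) (use assms in \<open>auto intro: ereal_norm_less unit_conv_nth\<close>)
    thus ?thesis using False by (simp add: prim_def)
  qed (simp add: prim_def)
qed

lemma has_contour_integral_linepath_0_spike:
  assumes "(f has_contour_integral i) (linepath 0 x)"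
    and "\<And>t. t \<in> closed_segment 0 x \<Longrightarrow> t \<noteq> 0 \<Longrightarrow> g t = f t"
  shows "(g has_contour_integral i) (linepath 0 x)"
  using assms(1) unfolding has_contour_integral_def
proof (rule has_integral_spike_finite[rotated 2])
  show "finite {0::real}" by simp
  fix s assume s: "s \<in> {0..1} - {0::real}"
  show "g (linepath 0 x s) * vector_derivative (linepath 0 x) (at s within {0..1}) =
        f (linepath 0 x s) * vector_derivative (linepath 0 x) (at s within {0..1})"
  proof (cases "x = 0")
    case True thus ?thesis using s by (simp add: vector_derivative_linepath_within)
  next
    case False
    have "linepath 0 x s \<in> closed_segment 0 x" using s linepath_in_path[of s 0 x] by auto
    moreover have "linepath 0 x s \<noteq> 0" using s False by (auto simp: scaleR_conv_of_real)
    ultimately show ?thesis using assms(2) by simp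
  qed
qed

text \<open>Integration against dt/t is the inverse of the Euler operator; t = 0 is a single point of
  the path, so the junk value of the integrand there does not matter.\<close>
lemma has_contour_integral_eval_fps_prim:
  fixes Q :: "complex fps"
  assumes rad: "1 \<le> fps_conv_radius (prim Q)" and Q0: "Q $ 0 = 0" and x: "norm x < 1"
  shows "((\<lambda>t. eval_fps Q t / t) has_contour_integral eval_fps (prim Q) x) (linepath 0 x)"
proof -
  define R where "R = prim Q"
  define dR where "dR = fps_deriv R"
  have rad_dR: "1 \<le> fps_conv_radius dR"
    using rad fps_conv_radius_deriv[of R] by (simp add: dR_def R_def order.trans)
  have X_dR: "fps_X * dR = Q"
  proof (rule fps_ext)
    fix n
    show "(fps_X * dR) $ n = Q $ n"
      by (cases n) (simp_all add: fps_X_mult_nth dR_def R_def prim_def Q0 del: of_nat_Suc)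
  qed
  have deriv: "(eval_fps R has_field_derivative eval_fps dR t) (at t within ball 0 1)"
    if "t \<in> ball 0 1" for t
    unfolding dR_def R_def
    by (rule has_field_derivative_eval_fps) (use that rad in \<open>auto intro: ereal_norm_less\<close>)
  have seg: "closed_segment 0 x \<subseteq> ball 0 1"
    by (rule closed_segment_subset) (use x in auto)
  have "eval_fps R 0 = 0"
    by (simp add: eval_fps_at_0 R_def prim_def)
  hence "(eval_fps dR has_contour_integral eval_fps R x) (linepath 0 x)"
    using contour_integral_primitive[OF deriv, of "linepath 0 x"] seg by auto
  moreover have "eval_fps Q t / t = eval_fps dR t" if "t \<in> closed_segment 0 x" "t \<noteq> 0" for t
  proof -
    have "eval_fps Q t = eval_fps (fps_X * dR) t"
      by (simp add: X_dR)
    also have "\<dots> = t * eval_fps dR t"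
    proof -
      have "norm t < 1"
        using that(1) seg by auto
      thus ?thesis
        by (subst eval_fps_mult) (use rad_dR in \<open>auto intro: ereal_norm_less\<close>)
    qed
    finally show ?thesis
      using that(2) by simp
  qed
  ultimately show ?thesis
    unfolding R_def by (rule has_contour_integral_linepath_0_spike)
qed

lemma eval_y_x_coef_mult_L1_fps_nth_0:
  assumes "a = zeta1 \<Longrightarrow> u \<noteq> []"
  shows "eval_y (x_coef a * L1_fps u) y $ 0 = 0"
proof -
  have "(x_coef a * L1_fps u) $ 0 = 0"
    using assms(1) by (auto simp: mult_nth_0 x_coef_nth_0 L1_fps_nth_0)
  thus ?thesis
    by (simp only: eval_y_nth eval_fps_0)
qed

text \<open>The words admitted here are those of the form theta1 W' with W' \<in> W0_1: the condition on the
  last letter makes the iterated integral converge at 0.\<close>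
lemma L1_eq_eval2:
  assumes "set u \<subseteq> {zeta1, zeta11, zeta12_1}" and "u = [] \<or> last u \<noteq> zeta1"
    and "norm y < 1" and "norm x < 1"
  shows "L1 u x y = eval2 (L1_fps u) x y"
  using assms
proof (induction u arbitrary: x)
  case Nil
  thus ?case by (simp add: eval2_def eval_y_1)
next
  case (Cons a u x)
  have a: "a \<in> {zeta1, zeta11, zeta12_1}" and y: "norm y < 1" and x: "norm x < 1"
    using Cons.prems by auto
  have IH: "L1 u t y = eval2 (L1_fps u) t y" if "norm t < 1" for t
    using Cons.IH[OF _ _ y that] Cons.prems(1,2) by (cases u) auto
  define Q where "Q = eval_y (x_coef a * L1_fps u) y"
  have Q: "Q = eval_y (x_coef a) y * eval_y (L1_fps u) y"
    unfolding Q_def by (rule eval_y_mult[OF unit_conv_x_coef unit_conv_L1_fps y])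
  have prim_Q: "eval_y (L1_fps (a # u)) y = prim Q"
    using eval_y_prim_x[OF unit_conv_mult[OF unit_conv_x_coef unit_conv_L1_fps] y]
    by (simp add: Q_def del: prim_x_nth)
  have "Q $ 0 = 0"
    unfolding Q_def by (rule eval_y_x_coef_mult_L1_fps_nth_0) (use Cons.prems(2) in auto)
  moreover have "1 \<le> fps_conv_radius (prim Q)"
    using unit_conv_eval_y[OF unit_conv_L1_fps y] prim_Q by metis
  ultimately have "((\<lambda>t. eval_fps Q t / t) has_contour_integral eval2 (L1_fps (a # u)) x y) (linepath 0 x)"
    using has_contour_integral_eval_fps_prim[OF _ _ x] prim_Q by (simp add: eval2_def)
  moreover have "coef a False (t, y) * L1 u t y = eval_fps Q t / t"
    if "t \<in> closed_segment 0 x" "t \<noteq> 0" for t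
  proof -
    have t: "norm t < 1"
      using that(1) x segment_bound(1)[of t 0 x] by simp
    have "eval_fps Q t = eval_fps (eval_y (x_coef a) y) t * eval_fps (eval_y (L1_fps u) y) t"
      unfolding Q by (rule eval_fps_mult)
        (use t y in \<open>auto intro: ereal_norm_less unit_conv_eval_y[OF unit_conv_x_coef]
          unit_conv_eval_y[OF unit_conv_L1_fps]\<close>)
    also have "\<dots> = t * coef a False (t, y) * L1 u t y"
      using eval_fps_eval_y_x_coef[OF a that(2) t y] IH[OF t] by (simp add: eval2_def)
    finally show ?thesis
      using that(2) by simp
  qed
  ultimately have "((\<lambda>t. coef a False (t, y) * L1 u t y) has_contour_integral
      eval2 (L1_fps (a # u)) x y) (linepath 0 x)"
    by (rule has_contour_integral_linepath_0_spike)
  thus ?case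
    by (simp add: contour_integral_unique)
qed

lemma infsum_eq_suminf: "summable (\<lambda>n. norm (f n :: complex)) \<Longrightarrow> infsum f UNIV = suminf f"
  by (rule infsumI) (rule norm_summable_imp_has_sum[OF _ summable_sums[OF summable_norm_cancel]])

lemma suminf_suminf_eq_infsum_infsum:
  fixes a :: "nat \<Rightarrow> nat \<Rightarrow> complex"
  assumes bnd: "\<And>i j. norm (a i j) \<le> M * r ^ i * s ^ j" and r: "0 \<le> r" "r < 1" and s: "0 \<le> s" "s < 1"
  shows "(\<Sum>i. \<Sum>j. a i j) = infsum (\<lambda>i. infsum (\<lambda>j. a i j) UNIV) UNIV"
proof -
  have sgj: "summable (\<lambda>j. M * r ^ i * s ^ j)" for i using s by (intro summable_mult summable_geometric) auto
  have sj: "summable (\<lambda>j. norm (a i j))" for i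
    by (rule summable_comparison_test'[OF sgj]) (use bnd in auto)
  have inner: "infsum (\<lambda>j. a i j) UNIV = (\<Sum>j. a i j)" for i by (rule infsum_eq_suminf[OF sj])
  have ib: "norm (\<Sum>j. a i j) \<le> M * r ^ i * (1 / (1 - s))" for i
  proof -
    have "norm (\<Sum>j. a i j) \<le> (\<Sum>j. norm (a i j))" by (rule summable_norm[OF sj])
    also have "\<dots> \<le> (\<Sum>j. M * r ^ i * s ^ j)" by (rule suminf_le[OF _ sj sgj]) (use bnd in auto)
    also have "\<dots> = M * r ^ i * (1 / (1 - s))" using s by (simp add: suminf_mult suminf_geometric)
    finally show ?thesis .
  qed
  have sgi: "summable (\<lambda>i. M * r ^ i * (1 / (1 - s)))" using r by (intro summable_mult2 summable_mult summable_geometric) auto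
  have si: "summable (\<lambda>i. norm (\<Sum>j. a i j))"
    by (rule summable_comparison_test'[OF sgi]) (use ib in auto)
  show ?thesis by (simp add: inner infsum_eq_suminf[OF si])
qed

lemma suminf_suminf_swap:
  fixes a :: "nat \<Rightarrow> nat \<Rightarrow> complex"
  assumes bnd: "\<And>i j. norm (a i j) \<le> M * r ^ i * s ^ j" and r: "0 \<le> r" "r < 1" and s: "0 \<le> s" "s < 1"
  shows "(\<Sum>i. \<Sum>j. a i j) = (\<Sum>j. \<Sum>i. a i j)"
proof -
  have M: "0 \<le> M" using bnd[of 0 0] by (metis norm_ge_zero order.trans mult.right_neutral power_0)
  define g where "g = (\<lambda>(i::nat, j::nat). M * r ^ i * s ^ j)"
  have gj: "(\<lambda>j. norm (g (i, j))) summable_on UNIV" for i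
    unfolding g_def using s M r
    by (intro norm_summable_imp_summable_on) (auto intro!: summable_mult summable_geometric simp: abs_mult)
  have gi_eq: "infsum (\<lambda>j. norm (g (i, j))) UNIV = M * r ^ i * (1 / (1 - s))" for i
  proof -
    have "infsum (\<lambda>j. norm (g (i, j))) UNIV = (\<Sum>j. norm (g (i, j)))"
    proof (rule infsumI, rule norm_summable_imp_has_sum)
      show "summable (\<lambda>n. norm (norm (g (i, n))))"
        unfolding g_def using s M r by (auto intro!: summable_mult summable_geometric simp: abs_mult)
      thus "(\<lambda>n. norm (g (i, n))) sums (\<Sum>j. norm (g (i, j)))" by (intro summable_sums) simp
    qed
    also have "\<dots> = (\<Sum>j. M * r ^ i * s ^ j)" using M r s by (simp add: g_def abs_mult)
    also have "\<dots> = M * r ^ i * (1 / (1 - s))" using s by (simp add: suminf_mult suminf_geometric)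
    finally show ?thesis .
  qed
  have gi: "(\<lambda>i. norm (infsum (\<lambda>j. norm (g (i, j))) UNIV)) summable_on UNIV"
    unfolding gi_eq using s M r
    by (intro norm_summable_imp_summable_on) (auto intro!: summable_mult summable_mult2 summable_geometric simp: abs_mult)
  have gS: "(\<lambda>x. norm (g x)) summable_on UNIV \<times> UNIV"
    using Infinite_Sum.abs_summable_on_Sigma_iff[where f=g and A=UNIV and B="\<lambda>_. UNIV"] gj gi by auto
  have aS: "(\<lambda>x. norm ((\<lambda>(i, j). a i j) x)) summable_on UNIV \<times> UNIV"
    by (rule Infinite_Sum.abs_summable_on_comparison_test[OF gS]) (use bnd M r s in \<open>auto simp: g_def abs_mult\<close>)
  hence aS': "(\<lambda>(i, j). a i j) summable_on UNIV \<times> UNIV" by (rule abs_summable_summable)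
  have "(\<Sum>i. \<Sum>j. a i j) = infsum (\<lambda>i. infsum (\<lambda>j. a i j) UNIV) UNIV"
    by (rule suminf_suminf_eq_infsum_infsum[OF bnd r s])
  also have "\<dots> = infsum (\<lambda>j. infsum (\<lambda>i. a i j) UNIV) UNIV"
    by (rule infsum_swap_banach[OF aS'])
  also have "\<dots> = (\<Sum>j. \<Sum>i. a i j)"
    by (rule suminf_suminf_eq_infsum_infsum[symmetric, of "\<lambda>j i. a i j" M s r]) (use bnd s r in \<open>auto simp: mult_ac\<close>)
  finally show ?thesis .
qed

lemma eval2_expand: "eval2 P x y = (\<Sum>i. (\<Sum>j. P $ i $ j * y ^ j) * x ^ i)"
  by (simp add: eval2_def eval_fps_def)

lemma eval2_swap_vars:
  assumes "coeffs_bounded M P" "norm x < 1" "norm y < 1"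
  shows "eval2 (swap_vars P) x y = eval2 P y x"
proof -
  define a where "a i j = P $ j $ i * y ^ j * x ^ i" for i j
  have bnd: "norm (a i j) \<le> M * norm x ^ i * norm y ^ j" for i j
  proof -
    have "norm (P $ j $ i) * (norm x ^ i * norm y ^ j) \<le> M * (norm x ^ i * norm y ^ j)"
      by (rule mult_right_mono) (use assms(1) in \<open>auto simp: coeffs_bounded_def\<close>)
    thus ?thesis by (simp add: a_def norm_mult norm_power mult_ac)
  qed
  have sjg: "summable (\<lambda>j. f j * z ^ j)" if "norm z < 1" "\<And>j. norm (f j) \<le> M" for f and z :: complex
  proof (rule summable_comparison_test'[where N=0])
    show "summable (\<lambda>j. M * norm z ^ j)" using that by (intro summable_mult summable_geometric) auto
    show "norm (f j * z ^ j) \<le> M * norm z ^ j" for j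
      using that(2)[of j] by (simp add: norm_mult norm_power mult_right_mono)
  qed
  have sj: "summable (\<lambda>j. P $ i $ j * z ^ j)" "summable (\<lambda>j. P $ j $ i * z ^ j)" if "norm z < 1" for i and z :: complex
    using assms(1) that by (auto simp: coeffs_bounded_def intro!: sjg)
  have "eval2 (swap_vars P) x y = (\<Sum>i. \<Sum>j. a i j)"
    unfolding eval2_expand a_def by (simp add: suminf_mult2[OF sj(2)[OF assms(3)]])
  also have "\<dots> = (\<Sum>j. \<Sum>i. a i j)"
    by (rule suminf_suminf_swap[OF bnd]) (use assms in auto)
  also have "\<dots> = (\<Sum>i. \<Sum>j. P $ i $ j * x ^ j * y ^ i)"
    by (simp add: a_def mult_ac)
  also have "\<dots> = eval2 P y x"
    unfolding eval2_expand by (simp add: suminf_mult2[OF sj(1)[OF assms(2)]])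
  finally show ?thesis .
qed

lemma coef_True_swap_form: "coef w True (x, t) = coef (swap_form w) False (t, x)"
  by (cases w) (auto simp: mult.commute)

lemma L2_eq_L1_swap_form: "L2 u x y = L1 (map swap_form u) y x"
  by (induction u arbitrary: y) (simp_all add: coef_True_swap_form)

lemma L2_eq_eval2:
  assumes "set u \<subseteq> {zeta2, zeta22, zeta12_2}" "u = [] \<or> last u \<noteq> zeta2" "norm x < 1" "norm y < 1"
  shows "L2 u x y = eval2 (L2_fps u) x y"
proof -
  have s: "set (map swap_form u) \<subseteq> {zeta1, zeta11, zeta12_1}" using assms(1) by auto
  have l: "map swap_form u = [] \<or> last (map swap_form u) \<noteq> zeta1"
    using assms(2) by (auto simp: last_map swap_form_eq_iff)
  have "L2 u x y = L1 (map swap_form u) y x" by (rule L2_eq_L1_swap_form)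
  also have "\<dots> = eval2 (L1_fps (map swap_form u)) y x" by (rule L1_eq_eval2[OF s l assms(3) assms(4)])
  also have "\<dots> = eval2 (L2_fps u) x y"
    unfolding L2_fps_def by (rule eval2_swap_vars[OF coeffs_bounded_L1_fps assms(3,4), symmetric])
  finally show ?thesis .
qed

section \<open>The maps iota and the proof of the theorem\<close>

lemma additive_sum:
  fixes h :: "complex \<Rightarrow> 'r::comm_ring_1"
  assumes "\<And>a b. h (a + b) = h a + h b" and "h 0 = 0"
  shows "h (sum f S) = (\<Sum>x\<in>S. h (f x))"
  by (induction S rule: infinite_finite_induct) (auto simp: assms)

lemma sum_card_splits_eq_split_sum:
  fixes X :: "form list \<Rightarrow> form list \<Rightarrow> 'r::comm_ring_1"
  assumes fin: "finite RP"
    and RP: "\<And>l u v. l \<le> length w \<Longrightarrow> word_map f (take l w) = Some u \<Longrightarrow>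
      word_map g (drop l w) = Some v \<Longrightarrow> (u, v) \<in> RP"
  shows "(\<Sum>p\<in>RP. of_nat (card {l. l \<le> length w \<and> word_map f (take l w) = Some (fst p) \<and>
      word_map g (drop l w) = Some (snd p)}) * X (fst p) (snd p)) = split_sum f g X w"
proof -
  define T where "T l p \<longleftrightarrow> word_map f (take l w) = Some (fst p) \<and> word_map g (drop l w) = Some (snd p)"
    for l p
  have card_eq: "of_nat (card {l. l \<le> length w \<and> T l p}) = (\<Sum>l=0..length w. if T l p then 1 else (0::'r))"
    for p
  proof -
    have "{l. l \<le> length w \<and> T l p} = {0..length w} \<inter> {l. T l p}"
      by auto
    thus ?thesis
      by (simp add: sum.If_cases)
  qed
  have term_eq: "(\<Sum>p\<in>RP. if T l p then X (fst p) (snd p) else 0) = split_term f g X w l"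
    if l: "l \<le> length w" for l
  proof (cases "\<exists>u v. word_map f (take l w) = Some u \<and> word_map g (drop l w) = Some v")
    case True
    then obtain u v where uv: "word_map f (take l w) = Some u" "word_map g (drop l w) = Some v"
      by blast
    have "(\<Sum>p\<in>RP. if T l p then X (fst p) (snd p) else 0) = (\<Sum>p\<in>RP. if p = (u, v) then X u v else 0)"
      by (intro sum.cong refl) (auto simp: T_def uv)
    also have "\<dots> = X u v"
      using RP[OF l uv] fin by simp
    finally show ?thesis
      by (simp add: split_term_def uv)
  next
    case False
    thus ?thesis
      by (auto simp: split_term_def T_def intro!: sum.neutral split: option.splits)
  qed
  have "(\<Sum>p\<in>RP. of_nat (card {l. l \<le> length w \<and> T l p}) * X (fst p) (snd p)) =
      (\<Sum>l=0..length w. \<Sum>p\<in>RP. if T l p then X (fst p) (snd p) else 0)"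
    unfolding card_eq sum_distrib_right by (subst sum.swap) (intro sum.cong refl, simp)
  also have "\<dots> = split_sum f g X w"
    by (simp add: split_sum_def term_eq)
  finally show ?thesis
    by (simp add: T_def)
qed

lemma sum_supp_iota_gen:
  fixes c :: "form list \<Rightarrow> complex" and h :: "complex \<Rightarrow> 'r::comm_ring_1"
    and X :: "form list \<Rightarrow> form list \<Rightarrow> 'r"
  assumes fin: "finite (supp c)"
    and h_add: "\<And>a b. h (a + b) = h a + h b" and h_mult: "\<And>a b. h (a * b) = h a * h b"
    and h_of_nat: "\<And>n. h (of_nat n) = of_nat n"
  shows "(\<Sum>p\<in>supp (iota_gen f g c). h (iota_gen f g c p) * X (fst p) (snd p)) =
         (\<Sum>w\<in>supp c. h (c w) * split_sum f g X w)"
proof -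
  have h0: "h 0 = 0"
    using h_of_nat[of 0] by simp
  define C where "C w p = {l. l \<le> length w \<and> word_map f (take l w) = Some (fst p) \<and>
    word_map g (drop l w) = Some (snd p)}" for w p
  have iota_eq: "iota_gen f g c p = (\<Sum>w\<in>supp c. c w * of_nat (card (C w p)))" for p
    by (cases p) (simp add: iota_gen_def C_def)
  define RP where "RP = (\<lambda>(w, l). (the (word_map f (take l w)), the (word_map g (drop l w)))) `
    (SIGMA w:supp c. {0..length w})"
  have fin_RP: "finite RP"
    unfolding RP_def using fin by auto
  have in_RP: "(u, v) \<in> RP" if "w \<in> supp c" "l \<le> length w"
    "word_map f (take l w) = Some u" "word_map g (drop l w) = Some v" for w l u v
    unfolding RP_def image_def
    by (rule CollectI, rule bexI[where x="(w, l)"]) (use that in auto)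
  have supp_RP: "supp (iota_gen f g c) \<subseteq> RP"
  proof
    fix p assume "p \<in> supp (iota_gen f g c)"
    hence "(\<Sum>w\<in>supp c. c w * of_nat (card (C w p))) \<noteq> 0"
      by (simp add: supp_def iota_eq)
    then obtain w where w: "w \<in> supp c" "card (C w p) \<noteq> 0"
      by (metis (no_types, lifting) mult_zero_right of_nat_0 sum.neutral)
    then obtain l where "l \<in> C w p"
      by fastforce
    thus "p \<in> RP"
      using in_RP[OF w(1)] by (cases p) (auto simp: C_def)
  qed
  have "(\<Sum>p\<in>supp (iota_gen f g c). h (iota_gen f g c p) * X (fst p) (snd p)) =
      (\<Sum>p\<in>RP. h (iota_gen f g c p) * X (fst p) (snd p))"
    by (rule sum.mono_neutral_left[OF fin_RP supp_RP]) (auto simp: supp_def h0)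
  also have "\<dots> = (\<Sum>p\<in>RP. \<Sum>w\<in>supp c. h (c w) * (of_nat (card (C w p)) * X (fst p) (snd p)))"
    by (simp add: iota_eq additive_sum[OF h_add h0] h_mult h_of_nat sum_distrib_left sum_distrib_right mult_ac)
  also have "\<dots> = (\<Sum>w\<in>supp c. h (c w) * (\<Sum>p\<in>RP. of_nat (card (C w p)) * X (fst p) (snd p)))"
    by (simp add: sum.swap[of _ RP] sum_distrib_left)
  also have "\<dots> = (\<Sum>w\<in>supp c. h (c w) * split_sum f g X w)"
    unfolding C_def by (intro sum.cong refl arg_cong2[where f="(*)"] sum_card_splits_eq_split_sum)
      (use fin_RP in_RP in auto)
  finally show ?thesis .
qed

lemma unit_conv_K21: "unit_conv (K21 w)"
  unfolding K21_def split_sum_def split_term_def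
  by (rule unit_conv_sum) (auto intro!: unit_conv_mult unit_conv_L1_fps unit_conv_L2_fps unit_conv_0
      split: option.splits)

lemma chen_reduced_split_right:
  assumes G: "chen_reduced \<phi>" and "\<phi> w \<noteq> 0" and V: "word_map pr1_21 (drop l w) = Some v"
  shows "set v \<subseteq> {zeta1, zeta11, zeta12_1} \<and> (v = [] \<or> last v \<noteq> zeta1)"
proof -
  have v: "v = drop l w"
    by (rule word_map_id[OF _ V]) (case_tac x; auto)
  have "set v \<subseteq> {zeta1, zeta11}"
    using word_map_range[OF V] by (auto dest!: pr1_21_range)
  moreover have "v = [] \<or> last v \<noteq> zeta1"
  proof (rule ccontr)
    assume "\<not> (v = [] \<or> last v \<noteq> zeta1)"
    hence "drop l w \<noteq> []" and "last (drop l w) = zeta1"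
      using v by auto
    hence "w = butlast w @ [zeta1]"
      by (metis append_butlast_last_id append_take_drop_id last_appendR append_is_Nil_conv)
    hence "\<phi> w = 0"
      using G unfolding chen_reduced_def by metis
    thus False
      using assms(2) by simp
  qed
  ultimately show ?thesis
    by auto
qed

lemma chen_reduced_split_left:
  assumes G: "chen_reduced \<phi>" and "\<phi> w \<noteq> 0" and U: "word_map pr2_21 (take l w) = Some u"
    and V: "word_map pr1_21 (drop l w) = Some v"
  shows "set u \<subseteq> {zeta2, zeta22, zeta12_2} \<and> (u = [] \<or> last u \<noteq> zeta2)"
proof -
  have "set u \<subseteq> {zeta2, zeta22, zeta12_2}"
    using word_map_range[OF U] pr2_21_range by blast
  moreover have "u = [] \<or> last u \<noteq> zeta2"
  proof (rule ccontr)
    assume "\<not> (u = [] \<or> last u \<noteq> zeta2)"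
    hence "u \<noteq> []" and "last u = zeta2"
      by auto
    with word_map_last[OF U] have ne: "take l w \<noteq> []" and "pr2_21 (last (take l w)) = Some zeta2"
      by auto
    hence last_take: "last (take l w) = zeta2"
      by (cases "last (take l w)") auto
    have "set (drop l w) \<subseteq> {zeta1, zeta11}"
    proof
      fix x assume "x \<in> set (drop l w)"
      hence "pr1_21 x \<noteq> None"
        using word_map_dom[OF V] by blast
      thus "x \<in> {zeta1, zeta11}"
        by (cases x) auto
    qed
    hence "\<phi> (butlast (take l w) @ zeta2 # drop l w) = 0"
      by (rule chen_reduced_zeta2_before_x_letters[OF G])
    moreover have "w = butlast (take l w) @ zeta2 # drop l w"
      using ne last_take
      by (metis append_butlast_last_id append_take_drop_id append.assoc append_Cons append_Nil)
    ultimately show False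
      using assms(2) by simp
  qed
  ultimately show ?thesis
    by auto
qed

lemma eval2_K21:
  assumes G: "chen_reduced \<phi>" and "\<phi> w \<noteq> 0" and x: "norm x < 1" and y: "norm y < 1"
  shows "eval2 (K21 w) x y = split_sum pr2_21 pr1_21 (\<lambda>u v. L2 u x y * L1 v x y) w"
proof -
  have "eval2 (K21 w) x y =
      (\<Sum>l=0..length w. eval2 (split_term pr2_21 pr1_21 (\<lambda>u v. L2_fps u * L1_fps v) w l) x y)"
    unfolding K21_def split_sum_def
    by (rule eval2_sum) (auto simp: split_term_def unit_conv_0 x y
        intro!: unit_conv_mult unit_conv_L1_fps unit_conv_L2_fps split: option.splits)
  also have "\<dots> = (\<Sum>l=0..length w. split_term pr2_21 pr1_21 (\<lambda>u v. L2 u x y * L1 v x y) w l)"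
  proof (rule sum.cong[OF refl])
    fix l
    show "eval2 (split_term pr2_21 pr1_21 (\<lambda>u v. L2_fps u * L1_fps v) w l) x y =
        split_term pr2_21 pr1_21 (\<lambda>u v. L2 u x y * L1 v x y) w l"
    proof (cases "word_map pr2_21 (take l w)"; cases "word_map pr1_21 (drop l w)")
      fix u v
      assume U: "word_map pr2_21 (take l w) = Some u" and V: "word_map pr1_21 (drop l w) = Some v"
      have "eval2 (L2_fps u * L1_fps v) x y = eval2 (L2_fps u) x y * eval2 (L1_fps v) x y"
        by (rule eval2_mult[OF unit_conv_L2_fps unit_conv_L1_fps x y])
      also have "\<dots> = L2 u x y * L1 v x y"
        using L2_eq_eval2[OF _ _ x y] L1_eq_eval2[OF _ _ y x]
          chen_reduced_split_left[OF G assms(2) U V] chen_reduced_split_right[OF G assms(2) V]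
        by simp
      finally show ?thesis
        using U V by (simp add: split_term_def)
    qed (simp_all add: split_term_def)
  qed
  finally show ?thesis
    by (simp add: split_sum_def)
qed

lemma theta1_in_W0_1:
  assumes "W' \<in> W0_1"
  shows "set (theta1 W') \<subseteq> {zeta1, zeta11, zeta12_1} \<and> (theta1 W' = [] \<or> last (theta1 W') \<noteq> zeta1)"
proof -
  have W: "set W' \<subseteq> {Z1, Z11, Z12}" "W' = [] \<or> last W' \<noteq> Z1"
    using assms by (auto simp: W0_1_def)
  moreover have "W' \<noteq> [] \<Longrightarrow> theta_letter1 (last W') \<noteq> zeta1"
    using W by (cases "last W'") (auto dest: last_in_set)
  ultimately show ?thesis
    by (auto simp: theta1_def last_map)
qed

lemma theta2_in_W0_2:
  assumes "W'' \<in> W0_2"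
  shows "set (theta2 W'') \<subseteq> {zeta2, zeta22, zeta12_2} \<and> (theta2 W'' = [] \<or> last (theta2 W'') \<noteq> zeta2)"
proof -
  have W: "set W'' \<subseteq> {Z2, Z22}" "W'' = [] \<or> last W'' \<noteq> Z2"
    using assms by (auto simp: W0_2_def)
  moreover have "W'' \<noteq> [] \<Longrightarrow> theta_letter2 (last W'') \<noteq> zeta2"
    using W by (cases "last W''") (auto dest: last_in_set)
  ultimately show ?thesis
    by (auto simp: theta2_def last_map)
qed

lemma wsum_K12_eq_if_iota12_eq:
  assumes "supp_within \<phi> n" and "finite (supp \<phi>)" and "iota12 \<phi> = tensor_basis u v"
  shows "wsum K12 n \<phi> = L1_fps u * L2_fps v"
proof -
  have "wsum K12 n \<phi> = (\<Sum>w\<in>supp \<phi>. const2 (\<phi> w) * split_sum pr1_12 pr2_12 (\<lambda>u v. L1_fps u * L2_fps v) w)"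
    by (simp add: wsum_supp[OF assms(1,2)] K12_def)
  also have "\<dots> = (\<Sum>p\<in>supp (iota12 \<phi>). const2 (iota12 \<phi> p) * (L1_fps (fst p) * L2_fps (snd p)))"
    unfolding iota12_def
    by (rule sum_supp_iota_gen[OF assms(2), symmetric]) (simp_all add: const2_add const2_mult const2_of_nat)
  also have "supp (iota12 \<phi>) = {(u, v)}"
    by (auto simp: assms(3) tensor_basis_def supp_def)
  finally show ?thesis
    by (simp add: assms(3) tensor_basis_def)
qed

lemma eval2_wsum_K21:
  assumes "chen_reduced \<phi>" and "supp_within \<phi> n" and "finite (supp \<phi>)"
    and x: "norm x < 1" and y: "norm y < 1"
  shows "eval2 (wsum K21 n \<phi>) x y = int_C21 (iota21 \<phi>) x y"
proof -
  have "eval2 (wsum K21 n \<phi>) x y = (\<Sum>w\<in>supp \<phi>. \<phi> w * eval2 (K21 w) x y)"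
    unfolding wsum_supp[OF assms(2,3)]
    by (subst eval2_sum) (auto simp: assms(3) eval2_mult[OF unit_conv_const2 unit_conv_K21 x y]
        intro!: unit_conv_mult unit_conv_const2 unit_conv_K21 x y)
  also have "\<dots> = (\<Sum>w\<in>supp \<phi>. \<phi> w * split_sum pr2_21 pr1_21 (\<lambda>u v. L2 u x y * L1 v x y) w)"
    by (intro sum.cong refl) (simp add: eval2_K21[OF assms(1) _ x y] supp_def)
  also have "\<dots> = (\<Sum>p\<in>supp (iota21 \<phi>). iota21 \<phi> p * (L2 (fst p) x y * L1 (snd p) x y))"
    unfolding iota21_def by (rule sum_supp_iota_gen[OF assms(3), where h="\<lambda>c. c", symmetric]) simp_all
  also have "\<dots> = int_C21 (iota21 \<phi>) x y"
    by (simp add: int_C21_def mult_ac)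
  finally show ?thesis .
qed

theorem theorem7p6:
  fixes z1 z2 :: complex and W' W'' :: "gen list" and \<phi> :: "form list \<Rightarrow> complex"
  assumes "0 < norm z1" and "norm z1 < 1" and "0 < norm z2" and "norm z2 < 1"
    and "W' \<in> W0_1" and "W'' \<in> W0_2"
    and "\<phi> \<in> barB0"
    and "iota12 \<phi> = tensor_basis (theta1 W') (theta2 W'')"
  shows "L1 (theta1 W') z1 z2 * L2 (theta2 W'') z1 z2 = int_C21 (iota21 \<phi>) z1 z2"
proof -
  note x = assms(2) and y = assms(4)
  obtain n where supp: "supp_within \<phi> n"
    using barB0_supp_within[OF assms(7)] .
  have fin: "finite (supp \<phi>)"
    using assms(7) by (simp add: barB0_def barB_def)
  have "L1 (theta1 W') z1 z2 * L2 (theta2 W'') z1 z2 =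
      eval2 (L1_fps (theta1 W')) z1 z2 * eval2 (L2_fps (theta2 W'')) z1 z2"
    using L1_eq_eval2[OF _ _ y x] L2_eq_eval2[OF _ _ x y]
      theta1_in_W0_1[OF assms(5)] theta2_in_W0_2[OF assms(6)] by simp
  also have "\<dots> = eval2 (wsum K12 n \<phi>) z1 z2"
    by (simp add: wsum_K12_eq_if_iota12_eq[OF supp fin assms(8)]
        eval2_mult[OF unit_conv_L1_fps unit_conv_L2_fps x y])
  also have "\<dots> = eval2 (wsum K21 n \<phi>) z1 z2"
    by (simp add: wsum_K12_eq_K21[OF barB0_chen_reduced[OF assms(7)] supp])
  also have "\<dots> = int_C21 (iota21 \<phi>) z1 z2"
    by (rule eval2_wsum_K21[OF barB0_chen_reduced[OF assms(7)] supp fin x y])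
  finally show ?thesis .
qed

end
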